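(* Let $\kappa>\omega$ be a regular cardinal. The following are equivalent: 1. $\kappa$ is not measurable. 2. For all objects $X$ of $\mathrm{QtNaamen}^+_\kappa$, if $X\xrightarrow{(i)}\{\kappa\}$ then $X\xrightarrow{(w)}\{\kappa\}$. 3. For all objects $X,Y$ of $\mathrm{QtNaamen}^+_\kappa$, if $X\xrightarrow{(i)}Y$ and $\perp\xrightarrow{(c)}Y$, then $X\xrightarrow{(wc)}Y$. 4. In the homotopy category $\mathrm{Ho}\,\mathrm{QtNaamen}^+_\kappa$, for all $X,Y$, if $X\xrightarrow{(i)}Y$ then $Y\to X$. Here $X\xrightarrow{(i)}Y$ means that there is an arrow $X\to Y$ (in the category in question) and it is indecomposable.
   Context: Work in ZFC with classes (for example, fix a transitive set model $V$ of ZFC and read "class" as "definable subset of $V$"). For classes of sets $X,Y$ write $X\to Y$ iff for every $x\in X$ there is $y\in Y$ with $x\subseteq y$. For a class $X$ of sets put $\bigcup_{<\kappa}X=\{\bigcup S: S\subseteq X,\ \mathrm{card}\,S<\kappa\}$. **The labelled category $\mathrm{StNaamen}_\kappa$.** Objects are the $\kappa$-directed classes of sets, i.e. those $X$ with $\bigcup_{<\kappa}X\to X$; there is at most one arrow between objects, given by $X\to Y$. An arrow $X\to Y$ is labelled - (wc) iff $\forall y\in Y\ \exists x\in X\ (\mathrm{card}(y\setminus x)<\kappa)$; - (c) iff $\forall y\in Y\ \exists x\in X\ (\mathrm{card}\,y\le\mathrm{card}\,x+\kappa)$; - (wf) iff $\forall x\in X\ \forall y\in Y\ \forall y'\subseteq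 y\ \exists x'\in X\ (\mathrm{card}\,y'\le\mathrm{card}\,x+\kappa\Rightarrow y'\subseteq x')$; - (w) iff there is $Z$ in $\mathrm{StNaamen}_\kappa$ with $X\xrightarrow{(wc)}Z\xrightarrow{(wf)}Y$. An object $X$ of $\mathrm{StNaamen}_\kappa$ is *cute* if: whenever $A\subseteq B$ are sets with $\{A\}\xrightarrow{(c)}\{B\}$, $W$ is an object with $W\xrightarrow{(wf)}\{B\}$, $W\to X$ and $\{A\}\to X$, then $\{B\}\to X$. **The labelled category $\mathrm{QtNaamen}^+_\kappa$.** Objects are all classes $X$ of sets such that $\bigcup_{<\kappa}X$ is cute in $\mathrm{StNaamen}_\kappa$. There is an (unique) arrow from $X$ to $Y$ iff $\bigcup_{<\kappa}X\to\bigcup_{<\kappa}Y$, and this arrow carries exactly the labels of $\bigcup_{<\kappa}X\to\bigcup_{<\kappa}Y$ in $\mathrm{StNaamen}_\kappa$. The initial object $\perp$ is the empty class (isomorphic to $\{\emptyset\}$). **Homotopy category.** $\mathrm{Ho}\,\mathrm{QtNaamen}^+_\kappa$ is obtained by formally inverting the (w)-labelled arrows: it has the same objects, at most one arrow between two objects, and there is an arrow from $X$ to $Y$ iff for some $n$ there is a finite zigzag $X\to X_1\xleftarrow{(w)}X_2\to X_3\xleftarrow{(w)}\cdots\to X_n\to Y$ in $\mathrm{QtNaamen}^+_\kappa$. **Indecomposable arrows.** An arrow $X\to Y$ in a category with at most one arrow between any two objects is *indecomposable* if whenever $X\to Z\to Y$, either $X\to Z$ is an isomorphism or $Z\to Y$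 is an isomorphism. **Measurable.** A cardinal $\kappa$ is measurable if it is uncountable and admits a $\kappa$-complete non-principal ultrafilter. *)

theory Defs
  imports Main
begin

datatype fm = Mem nat nat | Eq nat nat | Neg fm | Conj fm fm | All nat fm

primrec sat :: "('v \<Rightarrow> 'v \<Rightarrow> bool) \<Rightarrow> (nat \<Rightarrow> 'v) \<Rightarrow> fm \<Rightarrow> bool" where
  "sat E s (Mem i j) \<longleftrightarrow> E (s i) (s j)"
| "sat E s (Eq i j) \<longleftrightarrow> s i = s j"
| "sat E s (Neg p) \<longleftrightarrow> \<not> sat E s p"
| "sat E s (Conj p q) \<longleftrightarrow> sat E s p \<and> sat E s q"
| "sat E s (All i p) \<longleftrightarrow> (\<forall>x. sat E (s(i := x)) p)"

class set_mem =
  fixes mem :: "'a \<Rightarrow> 'a \<Rightarrow> bool"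

definition (in set_mem) elts :: "'a \<Rightarrow> 'a set" where
  "elts a = {x. mem x a}"

text \<open>
  Classes are the definable collections of sets. The values of the assignment at the
  variables other than 0 serve as parameters.
\<close>

definition (in set_mem) is_class :: "'a set \<Rightarrow> bool" where
  "is_class X \<longleftrightarrow> (\<exists>p s. X = {x. sat mem (s(0 := x)) p})"

definition (in set_mem) infinity_set :: "'a \<Rightarrow> bool" where
  "infinity_set w \<longleftrightarrow>
     (\<exists>e\<in>elts w. elts e = {}) \<and>
     (\<forall>x\<in>elts w. \<exists>y\<in>elts w. elts y = insert x (elts x))"

text \<open>
  First-order ZFC. Separation and replacement are schemes over formulas with parameters, so
  neither an inaccessible height nor external well-foundedness of the model is imposed.
\<close>

class zfc_model = set_mem +
  assumes zfc_extensionality: "elts a = elts b \<Longrightarrow> a = b"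
    and zfc_foundation: "elts a \<noteq> {} \<Longrightarrow> \<exists>x\<in>elts a. elts x \<inter> elts a = {}"
    and zfc_pairing: "\<exists>c. elts c = {a, b}"
    and zfc_union: "\<exists>c. elts c = \<Union> (elts ` elts a)"
    and zfc_power_set: "\<exists>c. elts c = {b. elts b \<subseteq> elts a}"
    and zfc_infinity: "\<exists>w. infinity_set w"
    and zfc_separation: "\<exists>b. elts b = {x \<in> elts a. sat mem (s(0 := x)) p}"
    and zfc_replacement:
      "(\<forall>x\<in>elts a. \<exists>!y. sat mem (s(0 := x, 1 := y)) p) \<Longrightarrow>
       \<exists>b. elts b = {y. \<exists>x\<in>elts a. sat mem (s(0 := x, 1 := y)) p}"
    and zfc_choice:
      "(\<forall>x\<in>elts a. elts x \<noteq> {}) \<Longrightarrow>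
       (\<forall>x\<in>elts a. \<forall>y\<in>elts a. x \<noteq> y \<longrightarrow> elts x \<inter> elts y = {}) \<Longrightarrow>
       \<exists>c. \<forall>x\<in>elts a. \<exists>!z. z \<in> elts x \<inter> elts c"

text \<open>
  The set with extension \<open>S\<close>. It is meaningful only when \<open>S\<close> is the extension of a set,
  which the axioms guarantee wherever it is used below.
\<close>

definition vset :: "'v::zfc_model set \<Rightarrow> 'v" where
  "vset S = (THE a. elts a = S)"

definition vsubset :: "'v::zfc_model \<Rightarrow> 'v \<Rightarrow> bool" where
  "vsubset a b \<longleftrightarrow> elts a \<subseteq> elts b"

definition vdiff :: "'v::zfc_model \<Rightarrow> 'v \<Rightarrow> 'v" where
  "vdiff a b = vset (elts a - elts b)"

definition vpair :: "'v::zfc_model \<Rightarrow> 'v \<Rightarrow> 'v" where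
  "vpair a b = vset {vset {a}, vset {a, b}}"

definition vsum :: "'v::zfc_model \<Rightarrow> 'v \<Rightarrow> 'v" where
  "vsum a b = vset (vpair (vset {}) ` elts a \<union> vpair (vset {vset {}}) ` elts b)"

text \<open>The restriction of \<open>g\<close> to \<open>a\<close> is (the graph of) a function that is a set of the model.\<close>

definition set_function :: "('v::zfc_model \<Rightarrow> 'v) \<Rightarrow> 'v \<Rightarrow> bool" where
  "set_function g a \<longleftrightarrow> (\<exists>f. elts f = (\<lambda>x. vpair x (g x)) ` elts a)"

text \<open>
  Cardinalities are compared in the sense of the model, by injections and bijections that
  belong to it. \<open>card_le a (vsum b c)\<close> thus says \<open>card a \<le> card b + card c\<close>.
\<close>

definition card_le :: "'v::zfc_model \<Rightarrow> 'v \<Rightarrow> bool" where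
  "card_le a b \<longleftrightarrow>
     (\<exists>g. set_function g a \<and> inj_on g (elts a) \<and> g ` elts a \<subseteq> elts b)"

definition card_eq :: "'v::zfc_model \<Rightarrow> 'v \<Rightarrow> bool" where
  "card_eq a b \<longleftrightarrow> (\<exists>g. set_function g a \<and> bij_betw g (elts a) (elts b))"

definition card_less :: "'v::zfc_model \<Rightarrow> 'v \<Rightarrow> bool" where
  "card_less a b \<longleftrightarrow> card_le a b \<and> \<not> card_le b a"

definition ordinal :: "'v::zfc_model \<Rightarrow> bool" where
  "ordinal a \<longleftrightarrow>
     (\<forall>x\<in>elts a. elts x \<subseteq> elts a) \<and>
     (\<forall>x\<in>elts a. x \<notin> elts x) \<and>
     (\<forall>x\<in>elts a. \<forall>y\<in>elts a. \<forall>z\<in>elts a. x \<in> elts y \<and> y \<in> elts z \<longrightarrow> x \<in> elts z) \<and>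
     (\<forall>b. elts b \<subseteq> elts a \<and> elts b \<noteq> {} \<longrightarrow> (\<exists>x\<in>elts b. \<forall>y\<in>elts b. x = y \<or> x \<in> elts y))"

definition cardinal :: "'v::zfc_model \<Rightarrow> bool" where
  "cardinal k \<longleftrightarrow> ordinal k \<and> (\<forall>a\<in>elts k. \<not> card_eq a k)"

definition omega :: "'v::zfc_model" where
  "omega = vset {n. \<forall>w. infinity_set w \<longrightarrow> n \<in> elts w}"

definition regular_cardinal :: "'v::zfc_model \<Rightarrow> bool" where
  "regular_cardinal k \<longleftrightarrow>
     cardinal k \<and> (k = omega \<or> omega \<in> elts k) \<and>
     \<not> (\<exists>a\<in>elts k. \<exists>g. set_function g a \<and> g ` elts a \<subseteq> elts k \<and>
          (\<forall>b\<in>elts k. \<exists>x\<in>elts a. b = g x \<or> b \<in> elts (g x)))"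

definition ultrafilter_on :: "'v::zfc_model \<Rightarrow> 'v \<Rightarrow> bool" where
  "ultrafilter_on k U \<longleftrightarrow>
     (\<forall>a\<in>elts U. vsubset a k) \<and> k \<in> elts U \<and> vset {} \<notin> elts U \<and>
     (\<forall>a\<in>elts U. \<forall>b. vsubset a b \<and> vsubset b k \<longrightarrow> b \<in> elts U) \<and>
     (\<forall>a\<in>elts U. \<forall>b\<in>elts U. vset (elts a \<inter> elts b) \<in> elts U) \<and>
     (\<forall>a. vsubset a k \<longrightarrow> a \<in> elts U \<or> vdiff k a \<in> elts U)"

definition complete_filter :: "'v::zfc_model \<Rightarrow> 'v \<Rightarrow> bool" where
  "complete_filter k U \<longleftrightarrow>
     (\<forall>S. vsubset S U \<and> elts S \<noteq> {} \<and> card_less S k \<longrightarrow> vset (\<Inter> (elts ` elts S)) \<in> elts U)"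

definition principal_on :: "'v::zfc_model \<Rightarrow> 'v \<Rightarrow> bool" where
  "principal_on k U \<longleftrightarrow> (\<exists>p\<in>elts k. elts U = {a. vsubset a k \<and> p \<in> elts a})"

definition measurable :: "'v::zfc_model \<Rightarrow> bool" where
  "measurable k \<longleftrightarrow>
     cardinal k \<and> omega \<in> elts k \<and>
     (\<exists>U. ultrafilter_on k U \<and> complete_filter k U \<and> \<not> principal_on k U)"

text \<open>
  The prefixes \<open>St_\<close>, \<open>Qt_\<close> and \<open>Ho_\<close> stand for StNaamen, QtNaamen\<open>\<^sup>+\<close> and the homotopy
  category of the latter; \<open>class_arr\<close> is the bare relation between arbitrary classes.
  Arrows of the categories carry the requirement that both ends are objects.
\<close>

definition class_arr :: "'v::zfc_model set \<Rightarrow> 'v set \<Rightarrow> bool" where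
  "class_arr X Y \<longleftrightarrow> (\<forall>x\<in>X. \<exists>y\<in>Y. vsubset x y)"

definition small_unions :: "'v::zfc_model \<Rightarrow> 'v set \<Rightarrow> 'v set" where
  "small_unions k X =
     {u. \<exists>S. elts S \<subseteq> X \<and> card_less S k \<and> elts u = \<Union> (elts ` elts S)}"

definition St_obj :: "'v::zfc_model \<Rightarrow> 'v set \<Rightarrow> bool" where
  "St_obj k X \<longleftrightarrow> is_class X \<and> class_arr (small_unions k X) X"

definition St_arr :: "'v::zfc_model \<Rightarrow> 'v set \<Rightarrow> 'v set \<Rightarrow> bool" where
  "St_arr k X Y \<longleftrightarrow> St_obj k X \<and> St_obj k Y \<and> class_arr X Y"

definition St_wc :: "'v::zfc_model \<Rightarrow> 'v set \<Rightarrow> 'v set \<Rightarrow> bool" where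
  "St_wc k X Y \<longleftrightarrow> St_arr k X Y \<and> (\<forall>y\<in>Y. \<exists>x\<in>X. card_less (vdiff y x) k)"

definition St_c :: "'v::zfc_model \<Rightarrow> 'v set \<Rightarrow> 'v set \<Rightarrow> bool" where
  "St_c k X Y \<longleftrightarrow> St_arr k X Y \<and> (\<forall>y\<in>Y. \<exists>x\<in>X. card_le y (vsum x k))"

definition St_wf :: "'v::zfc_model \<Rightarrow> 'v set \<Rightarrow> 'v set \<Rightarrow> bool" where
  "St_wf k X Y \<longleftrightarrow> St_arr k X Y \<and>
     (\<forall>x\<in>X. \<forall>y\<in>Y. \<forall>y'. vsubset y' y \<longrightarrow>
        (\<exists>x'\<in>X. card_le y' (vsum x k) \<longrightarrow> vsubset y' x'))"

definition St_w :: "'v::zfc_model \<Rightarrow> 'v set \<Rightarrow> 'v set \<Rightarrow> bool" where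
  "St_w k X Y \<longleftrightarrow> (\<exists>Z. St_wc k X Z \<and> St_wf k Z Y)"

definition cute :: "'v::zfc_model \<Rightarrow> 'v set \<Rightarrow> bool" where
  "cute k X \<longleftrightarrow> St_obj k X \<and>
     (\<forall>A B W. vsubset A B \<and> St_c k {A} {B} \<and> St_wf k W {B} \<and>
        St_arr k W X \<and> St_arr k {A} X \<longrightarrow> St_arr k {B} X)"

definition Qt_obj :: "'v::zfc_model \<Rightarrow> 'v set \<Rightarrow> bool" where
  "Qt_obj k X \<longleftrightarrow> is_class X \<and> cute k (small_unions k X)"

definition Qt_arr :: "'v::zfc_model \<Rightarrow> 'v set \<Rightarrow> 'v set \<Rightarrow> bool" where
  "Qt_arr k X Y \<longleftrightarrow> Qt_obj k X \<and> Qt_obj k Y \<and> St_arr k (small_unions k X) (small_unions k Y)"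

definition Qt_wc :: "'v::zfc_model \<Rightarrow> 'v set \<Rightarrow> 'v set \<Rightarrow> bool" where
  "Qt_wc k X Y \<longleftrightarrow> Qt_arr k X Y \<and> St_wc k (small_unions k X) (small_unions k Y)"

definition Qt_c :: "'v::zfc_model \<Rightarrow> 'v set \<Rightarrow> 'v set \<Rightarrow> bool" where
  "Qt_c k X Y \<longleftrightarrow> Qt_arr k X Y \<and> St_c k (small_unions k X) (small_unions k Y)"

definition Qt_w :: "'v::zfc_model \<Rightarrow> 'v set \<Rightarrow> 'v set \<Rightarrow> bool" where
  "Qt_w k X Y \<longleftrightarrow> Qt_arr k X Y \<and> St_w k (small_unions k X) (small_unions k Y)"

text \<open>
  Finite zigzags \<open>X \<rightarrow> X\<^sub>1 \<leftarrow> X\<^sub>2 \<rightarrow> X\<^sub>3 \<leftarrow> \<dots> \<rightarrow> Y\<close> whose backward arrows are labelled (w).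
  Since arrows compose, consecutive forward arrows are recorded as a single one.
\<close>

inductive Ho_arr :: "'v::zfc_model \<Rightarrow> 'v set \<Rightarrow> 'v set \<Rightarrow> bool" for k where
  forward: "Qt_arr k X Y \<Longrightarrow> Ho_arr k X Y"
| zigzag: "Qt_arr k X X1 \<Longrightarrow> Qt_w k X2 X1 \<Longrightarrow> Ho_arr k X2 Y \<Longrightarrow> Ho_arr k X Y"

text \<open>
  A category with at most one arrow between any two objects is given by its arrow relation;
  an arrow is then an isomorphism when there is an arrow back.
\<close>

definition thin_iso :: "('o \<Rightarrow> 'o \<Rightarrow> bool) \<Rightarrow> 'o \<Rightarrow> 'o \<Rightarrow> bool" where
  "thin_iso R X Y \<longleftrightarrow> R X Y \<and> R Y X"

definition indecomposable :: "('o \<Rightarrow> 'o \<Rightarrow> bool) \<Rightarrow> 'o \<Rightarrow> 'o \<Rightarrow> bool" where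
  "indecomposable R X Y \<longleftrightarrow>
     R X Y \<and> (\<forall>Z. R X Z \<and> R Z Y \<longrightarrow> thin_iso R X Z \<or> thin_iso R Z Y)"

end

theory Submission
  imports Defs
begin

text \<open>
  Everything is reduced to \<open>\<kappa>\<close>-complete ideals, that is, to classes closed under subsets and under
  unions of fewer than \<open>\<kappa>\<close> members. Up to isomorphism an object of the category QtNaamen\<open>\<^sup>+\<close> is the
  ideal \<open>cov X\<close> that it generates, and in the homotopy category only the ideal \<open>star X\<close> matters: the
  sets that are, up to fewer than \<open>\<kappa>\<close> elements, in \<open>cov X\<close>, and that are of size at most \<open>\<kappa>\<close>
  (more precisely, unions of fewer than \<open>\<kappa>\<close> sets of that size). If \<open>X \<rightarrow> Y\<close> is
  indecomposable and \<open>b\<close> lies in the ideal of \<open>Y\<close> but not in that of \<open>X\<close>, then adjoining \<open>a \<subseteq> b\<close>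
  to \<open>X\<close> shows that the ideal of \<open>X\<close> contains \<open>a\<close> or \<open>b - a\<close>, so it is prime on \<open>b\<close>. If \<open>\<kappa>\<close> is
  not measurable, such an ideal is principal: it omits a singleton. Conversely, the ideal dual
  to a \<open>\<kappa>\<close>-complete non-principal ultrafilter is a counterexample to the other three conditions.
\<close>

section \<open>Definability in a model of set theory\<close>

text \<open>The model is seen from outside and may be ill-founded, so a HOL subset of the extension
  of a set need not be a set of the model. Everything fed to separation, replacement or
  \<open>is_class\<close> must therefore come with a proof of definability; the rules
  \<open>dintros\<close> produce these proofs by following the shape of the expression. The only
  ordinals in use are the elements of \<kappa>, and size estimates are reduced to covering by some
  \<alpha> in \<kappa> or to membership in an ideal.

  The form of \<open>star\<close> comes from the two halves of a (w) arrow. A (wf) arrow lifts every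
  set of \<open>kbdd\<close>, whatever the sizes in its source, and a (wc) arrow disregards fewer
  than \<kappa> elements; \<open>star\<close> keeps what is insensitive to both. The set
  \<open>kbdd\<close> also removes the obstacle posed by cuteness: a class inside
  \<open>kbdd\<close> is always an object, so the intermediate objects needed for factorizations and
  zigzags are all taken from there.\<close>

primrec ren :: "(nat \<Rightarrow> nat) \<Rightarrow> fm \<Rightarrow> fm" where
  "ren f (Mem i j) = Mem (f i) (f j)"
| "ren f (Eq i j) = Eq (f i) (f j)"
| "ren f (Neg p) = Neg (ren f p)"
| "ren f (Conj p q) = Conj (ren f p) (ren f q)"
| "ren f (All i p) = All (f i) (ren f p)"

text \<open>Injectivity prevents capture: updating the assignment at \<open>f i\<close> changes the
  value seen at \<open>i\<close> and at no other variable.\<close>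

lemma sat_ren: "inj f \<Longrightarrow> sat E s (ren f p) \<longleftrightarrow> sat E (\<lambda>n. s (f n)) p"
proof (induction p arbitrary: s)
  case (All i p)
  have "(\<lambda>n. (s(f i := x)) (f n)) = (\<lambda>n. s (f n))(i := x)" for x
    using All.prems by (auto simp: fun_eq_iff inj_eq)
  with All show ?case by simp
qed simp_all

definition interleave :: "(nat \<Rightarrow> 'a) \<Rightarrow> (nat \<Rightarrow> 'a) \<Rightarrow> nat \<Rightarrow> 'a" where
  "interleave s t n = (if even n then s (n div 2) else t (n div 2))"

lemma interleave_simps [simp]:
  "interleave s t (2 * n) = s n" "interleave s t (Suc (2 * n)) = t n"
  "interleave s t (Suc (Suc (2 * n))) = s (Suc n)"
  "interleave s t (Suc (Suc (Suc (2 * n)))) = t (Suc n)"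
  "interleave s t 0 = s 0" "interleave s t (Suc 0) = t 0"
  "interleave s t (Suc (4 * n)) = t (2 * n)" "interleave s t (Suc (Suc (Suc (4 * n)))) = t (Suc (2 * n))"
proof -
  have "Suc (4 * n) div 2 = 2 * n" "Suc (Suc (Suc (4 * n))) div 2 = Suc (2 * n)" by presburger+
  then show "interleave s t (Suc (4 * n)) = t (2 * n)"
    "interleave s t (Suc (Suc (Suc (4 * n)))) = t (Suc (2 * n))"
    by (simp_all add: interleave_def)
qed (simp_all add: interleave_def)

text \<open>
  Definable predicates and operations of an assignment. The even variables of the formula are
  the arguments, the odd ones hold parameters; so a quantifier can always bind a parameter slot,
  and conjunctions can merge two parameter lists by renaming.
\<close>

definition defP :: "((nat \<Rightarrow> 'v::zfc_model) \<Rightarrow> bool) \<Rightarrow> bool" where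
  "defP P \<longleftrightarrow> (\<exists>p t. \<forall>s. P s \<longleftrightarrow> sat mem (interleave s t) p)"

definition defT :: "((nat \<Rightarrow> 'v::zfc_model) \<Rightarrow> 'v) \<Rightarrow> bool" where
  "defT F \<longleftrightarrow> defP (\<lambda>s. s 0 = F (\<lambda>n. s (Suc n)))"

named_theorems dintros

lemma defPI:
  assumes "inj f" and "\<And>s n. interleave s t (f n) = e s n" and "\<And>s. P s \<longleftrightarrow> sat mem (e s) p"
  shows "defP P"
proof -
  have "P s \<longleftrightarrow> sat mem (interleave s t) (ren f p)" for s
    using assms by (simp add: sat_ren)
  then show ?thesis unfolding defP_def by blast
qed

lemma even_odd_cases: obtains m where "n = 2 * m" | m where "n = Suc (2 * m)"
  by (metis evenE oddE Suc_eq_plus1)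

lemma inj_even_odd:
  assumes "\<And>m n. g m = g n \<Longrightarrow> m = n" "\<And>m n. h m = h n \<Longrightarrow> m = n" "\<And>m n. g m \<noteq> h n"
  shows "inj (interleave g h)"
proof (rule injI)
  fix m n assume "interleave g h m = interleave g h n"
  then show "m = n"
    by (cases m rule: even_odd_cases; cases n rule: even_odd_cases) (use assms in \<open>auto, metis\<close>)
qed

lemma defP_ren:
  assumes "inj f" "defP P" shows "defP (\<lambda>s. P (\<lambda>n. s (f n)))"
proof -
  obtain p t where p: "\<And>s. P s \<longleftrightarrow> sat mem (interleave s t) p"
    using assms(2) unfolding defP_def by blast
  show ?thesis
  proof (rule defPI)
    show "inj (interleave (\<lambda>n. 2 * f n) (\<lambda>n. Suc (2 * n)))"
      using assms(1) by (intro inj_even_odd) (auto simp: inj_eq, presburger)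
    show "interleave s t (interleave (\<lambda>n. 2 * f n) (\<lambda>n. Suc (2 * n)) n)
        = interleave (\<lambda>n. s (f n)) t n" for s n
      by (cases n rule: even_odd_cases) auto
    show "P (\<lambda>n. s (f n)) \<longleftrightarrow> sat mem (interleave (\<lambda>n. s (f n)) t) p" for s
      by (rule p)
  qed
qed

lemma defP_not [dintros]: "defP P \<Longrightarrow> defP (\<lambda>s. \<not> P s)"
  unfolding defP_def by (metis sat.simps(3))

lemma defP_conj [dintros]:
  assumes "defP P" "defP Q" shows "defP (\<lambda>s. P s \<and> Q s)"
proof -
  obtain p t where p: "\<And>s. P s \<longleftrightarrow> sat mem (interleave s t) p"
    using assms(1) unfolding defP_def by blast
  obtain q u where q: "\<And>s. Q s \<longleftrightarrow> sat mem (interleave s u) q"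
    using assms(2) unfolding defP_def by blast
  \<comment> \<open>The arguments stay shared, while the parameters of \<open>p\<close> go to the
    even positions of \<open>?tu\<close> and those of \<open>q\<close> to the odd ones.\<close>
  let ?f = "interleave (\<lambda>n. 2 * n) (\<lambda>n. Suc (4 * n))"
  let ?g = "interleave (\<lambda>n. 2 * n) (\<lambda>n. Suc (Suc (Suc (4 * n))))"
  have f: "inj ?f" by (intro inj_even_odd) (auto, presburger)
  have g: "inj ?g" by (intro inj_even_odd) (auto, presburger)
  let ?tu = "interleave t u"
  have "(\<lambda>n. interleave s ?tu (?f n)) = interleave s t" for s
  proof
    fix n show "interleave s ?tu (?f n) = interleave s t n"
      by (cases n rule: even_odd_cases) auto
  qed
  moreover have "(\<lambda>n. interleave s ?tu (?g n)) = interleave s u" for s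
  proof
    fix n show "interleave s ?tu (?g n) = interleave s u n"
      by (cases n rule: even_odd_cases) auto
  qed
  ultimately have "P s \<and> Q s \<longleftrightarrow> sat mem (interleave s ?tu) (Conj (ren ?f p) (ren ?g q))" for s
    using p q by (simp add: sat_ren f g)
  then show ?thesis unfolding defP_def by blast
qed

lemma defP_all [dintros]:
  assumes "defP (\<lambda>s. Q (s 0) (\<lambda>n. s (Suc n)))" shows "defP (\<lambda>s. \<forall>x. Q x s)"
proof -
  obtain p t where p: "\<And>s. Q (s 0) (\<lambda>n. s (Suc n)) \<longleftrightarrow> sat mem (interleave s t) p"
    using assms unfolding defP_def by blast
  \<comment> \<open>Argument 0 of \<open>Q\<close> becomes variable 1, the first odd slot, and the
    other arguments move down by one. The parameters move up by one to free that slot, so the entry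
    of \<open>?t\<close> at 0 is a dummy that the quantifier overwrites.\<close>
  let ?f = "interleave (case_nat 1 (\<lambda>n. 2 * n)) (\<lambda>n. Suc (2 * Suc n))"
  have f: "inj ?f"
  proof (rule inj_even_odd)
    show "case_nat 1 (\<lambda>n. 2 * n) m = case_nat 1 (\<lambda>n. 2 * n) n \<Longrightarrow> m = n" for m n :: nat
      by (auto split: nat.splits)
    show "case_nat 1 (\<lambda>n. 2 * n) m \<noteq> Suc (2 * Suc n)" for m n :: nat
      by (cases m) (simp_all, presburger)
  qed auto
  let ?t = "case_nat (t 0) t"
  have e: "(\<lambda>n. ((interleave s ?t)(1 := x)) (?f n)) = interleave (case_nat x s) t" for s x
  proof
    fix n show "((interleave s ?t)(1 := x)) (?f n) = interleave (case_nat x s) t n"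
    proof (cases n rule: even_odd_cases)
      case (1 m)
      moreover have "2 * k \<noteq> Suc 0" for k by presburger
      ultimately show ?thesis by (cases m) auto
    next
      case (2 m)
      then show ?thesis by (auto simp del: mult_Suc_right)
    qed
  qed
  have "(\<forall>x. Q x s) \<longleftrightarrow> sat mem (interleave s ?t) (All 1 (ren ?f p))" for s
    using p[of "case_nat _ s"] by (simp only: sat.simps sat_ren[OF f] e) simp
  then show ?thesis unfolding defP_def by blast
qed

lemma defP_const [dintros]: "defP (\<lambda>s. b)"
proof -
  have "sat mem s (Eq 0 0)" "\<not> sat mem s (Neg (Eq 0 0))" for s :: "nat \<Rightarrow> 'a"
    by simp_all
  then show ?thesis unfolding defP_def by (metis (full_types))
qed

lemma defP_disj [dintros]: "defP P \<Longrightarrow> defP Q \<Longrightarrow> defP (\<lambda>s. P s \<or> Q s)"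
  using defP_not[OF defP_conj[OF defP_not[of P] defP_not[of Q]]] by simp

lemma defP_imp [dintros]: "defP P \<Longrightarrow> defP Q \<Longrightarrow> defP (\<lambda>s. P s \<longrightarrow> Q s)"
  using defP_not[OF defP_conj[OF _ defP_not[of Q]], of P] by simp

lemma defP_iff [dintros]: "defP P \<Longrightarrow> defP Q \<Longrightarrow> defP (\<lambda>s. P s \<longleftrightarrow> Q s)"
  using defP_conj[OF defP_imp[of P Q] defP_imp[of Q P]] by (simp add: iff_conv_conj_imp)

lemma defP_ex [dintros]:
  "defP (\<lambda>s. Q (s 0) (\<lambda>n. s (Suc n))) \<Longrightarrow> defP (\<lambda>s. \<exists>x. Q x s)"
  using defP_not[OF defP_all[of "\<lambda>x s. \<not> Q x s"], OF defP_not] by simp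

text \<open>Formulas have no function symbols, so a term is substituted by quantifying over its
  value: \<open>\<exists>x. x = F s \<and> Q x s\<close>.\<close>

lemma defP_subst:
  assumes "defT F" "defP (\<lambda>s. Q (s 0) (\<lambda>n. s (Suc n)))" shows "defP (\<lambda>s. Q (F s) s)"
proof -
  have "defP (\<lambda>s. \<exists>x. x = F s \<and> Q x s)"
    using assms by (intro dintros) (simp_all add: defT_def)
  then show ?thesis by simp
qed


lemma defP_var_mem: "defP (\<lambda>s. mem (s i) (s j))"
  and defP_var_eq: "defP (\<lambda>s. s i = s j)"
  unfolding defP_def
  by (rule exI[of _ "Mem (2 * i) (2 * j)"] exI[of _ "Eq (2 * i) (2 * j)"], simp)+

text \<open>\<open>defP_subst\<close> acts on argument 0 only; this renaming and the next two bring
  another argument there or make room for a fresh one.\<close>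

lemma defP_swap:
  "defP P \<Longrightarrow> defP (\<lambda>s. P (\<lambda>n. s (case n of 0 \<Rightarrow> Suc 0 | Suc 0 \<Rightarrow> 0 | Suc (Suc n) \<Rightarrow> Suc (Suc n))))"
  by (rule defP_ren) (auto simp: inj_def split: nat.splits)

lemma defP_swap':
  "defP P \<Longrightarrow> defP (\<lambda>s. P (\<lambda>n. s (case n of 0 \<Rightarrow> 0 | Suc 0 \<Rightarrow> Suc (Suc 0)
    | Suc (Suc 0) \<Rightarrow> Suc 0 | Suc (Suc (Suc n)) \<Rightarrow> Suc (Suc (Suc n)))))"
  by (rule defP_ren) (auto simp: inj_def split: nat.splits)

lemma defP_skip: "defP P \<Longrightarrow> defP (\<lambda>s. P (\<lambda>n. s (case n of 0 \<Rightarrow> 0 | Suc n \<Rightarrow> Suc (Suc n))))"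
  by (rule defP_ren) (auto simp: inj_def split: nat.splits)

lemma defT_var [dintros]: "defT (\<lambda>s. s i)"
  unfolding defT_def by (rule defP_var_eq)

lemma defT_const [dintros]: "defT (\<lambda>s. c)"
proof -
  have "s 0 = c \<longleftrightarrow> sat mem (interleave s (\<lambda>_. c)) (Eq 0 (Suc 0))" for s
    by simp
  then show ?thesis unfolding defT_def defP_def by blast
qed

lemma defT_shift: "defT F \<Longrightarrow> defT (\<lambda>s. F (\<lambda>n. s (Suc n)))"
  unfolding defT_def
  by (drule defP_skip) simp

lemma defP_shift: "defP P \<Longrightarrow> defP (\<lambda>s. P (\<lambda>n. s (Suc n)))"
  using defP_ren[of Suc P] by simp

text \<open>Definability of a fixed predicate or operation is established once in this form and then
  applied to arbitrary definable terms by the rules ending in \<open>D\<close>.\<close>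

definition defP1 where "defP1 P \<longleftrightarrow> defP (\<lambda>s. P (s 0))"
definition defP2 where "defP2 P \<longleftrightarrow> defP (\<lambda>s. P (s 0) (s (Suc 0)))"
definition defT1 where "defT1 P \<longleftrightarrow> defT (\<lambda>s. P (s 0))"
definition defT2 where "defT2 P \<longleftrightarrow> defT (\<lambda>s. P (s 0) (s (Suc 0)))"

lemma defP1D: "defP1 P \<Longrightarrow> defT a \<Longrightarrow> defP (\<lambda>s. P (a s))"
  unfolding defP1_def by (erule defP_subst)

lemma defP2D:
  assumes "defP2 P" "defT a" "defT b" shows "defP (\<lambda>s. P (a s) (b s))"
proof (rule defP_subst[OF assms(2)], rule defP_subst[OF defT_shift[OF assms(3)]])
  show "defP (\<lambda>s. P (s (Suc 0)) (s 0))"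
    using defP_swap[OF assms(1)[unfolded defP2_def]] by simp
qed

lemma defT_subst:
  assumes "defT F" "defT (\<lambda>s. G (s 0) (\<lambda>n. s (Suc n)))" shows "defT (\<lambda>s. G (F s) s)"
proof -
  have "defP (\<lambda>s. s (Suc 0) = G (s 0) (\<lambda>n. s (Suc (Suc n))))"
    using defP_swap[OF assms(2)[unfolded defT_def]] by simp
  then show ?thesis
    unfolding defT_def
    by (intro defP_subst[OF defT_shift[OF assms(1)], where Q = "\<lambda>y s. s 0 = G y (\<lambda>n. s (Suc n))"])
qed

lemma defT1D: "defT1 G \<Longrightarrow> defT a \<Longrightarrow> defT (\<lambda>s. G (a s))"
  unfolding defT1_def by (erule defT_subst)

lemma defT2D:
  assumes "defT2 P" "defT a" "defT b" shows "defT (\<lambda>s. P (a s) (b s))"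
proof (rule defT_subst[OF assms(2)], rule defT_subst[OF defT_shift[OF assms(3)]])
  show "defT (\<lambda>s. P (s (Suc 0)) (s 0))"
    using defP_swap'[OF assms(1)[unfolded defT2_def defT_def]] by (simp add: defT_def)
qed

lemma defP_eq [dintros]: "defT a \<Longrightarrow> defT b \<Longrightarrow> defP (\<lambda>s. a s = b s)"
  by (rule defP2D[where P = "(=)"]) (auto simp: defP2_def defP_var_mem defP_var_eq)

lemma defP_mem: "defT a \<Longrightarrow> defT b \<Longrightarrow> defP (\<lambda>s. mem (a s) (b s))"
  by (rule defP2D[where P = "mem"]) (auto simp: defP2_def defP_var_mem defP_var_eq)

lemma defP_elts [dintros]: "defT a \<Longrightarrow> defT b \<Longrightarrow> defP (\<lambda>s. a s \<in> elts (b s))"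
  by (simp add: elts_def defP_mem)

lemma defP_Collect [dintros]: "defP (\<lambda>s. P (a s) s) \<Longrightarrow> defP (\<lambda>s. a s \<in> {x. P x s})"
  by simp

lemma defP_Un [dintros]:
  "defP (\<lambda>s. a s \<in> A s) \<Longrightarrow> defP (\<lambda>s. a s \<in> B s) \<Longrightarrow> defP (\<lambda>s. a s \<in> A s \<union> B s)"
  and defP_Diff [dintros]:
  "defP (\<lambda>s. a s \<in> A s) \<Longrightarrow> defP (\<lambda>s. a s \<in> B s) \<Longrightarrow> defP (\<lambda>s. a s \<in> A s - B s)"
  by (simp_all add: defP_conj defP_disj defP_not)

lemma defP_empty [dintros]: "defP (\<lambda>s. a s \<in> {})"
  by (simp add: defP_const)

lemma defP_insert [dintros]:
  "defT a \<Longrightarrow> defT b \<Longrightarrow> defP (\<lambda>s. a s \<in> A s) \<Longrightarrow> defP (\<lambda>s. a s \<in> insert (b s) (A s))"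
  by (simp add: defP_disj defP_eq)

lemma defP_image [dintros]:
  "defP (\<lambda>s. \<exists>x. x \<in> A s \<and> a s = F x s) \<Longrightarrow> defP (\<lambda>s. a s \<in> (\<lambda>x. F x s) ` A s)"
  by (simp add: image_iff Bex_def)

lemma defP_UN [dintros]:
  "defP (\<lambda>s. \<exists>x. x \<in> A s \<and> a s \<in> B x s) \<Longrightarrow> defP (\<lambda>s. a s \<in> (\<Union>x\<in>A s. B x s))"
  by (simp add: Bex_def)

lemma defP_INT [dintros]:
  "defP (\<lambda>s. \<forall>x. x \<in> A s \<longrightarrow> a s \<in> B x s) \<Longrightarrow> defP (\<lambda>s. a s \<in> (\<Inter>x\<in>A s. B x s))"
  by (simp add: Ball_def[of "A _"] INT_iff)

lemma defP_Ball [dintros]: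
  "defP (\<lambda>s. \<forall>x. x \<in> A s \<longrightarrow> Q x s) \<Longrightarrow> defP (\<lambda>s. \<forall>x\<in>A s. Q x s)"
  by (simp add: Ball_def)

lemma defP_Bex [dintros]:
  "defP (\<lambda>s. \<exists>x. x \<in> A s \<and> Q x s) \<Longrightarrow> defP (\<lambda>s. \<exists>x\<in>A s. Q x s)"
  by (simp add: Bex_def)

lemma defP_subset [dintros]:
  "defP (\<lambda>s. \<forall>x. x \<in> A s \<longrightarrow> x \<in> B s) \<Longrightarrow> defP (\<lambda>s. A s \<subseteq> B s)"
  by (simp add: subset_iff)

lemma defP_set_eq [dintros]:
  "defP (\<lambda>s. \<forall>x. x \<in> A s \<longleftrightarrow> x \<in> B s) \<Longrightarrow> defP (\<lambda>s. A s = B s)"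
  by (simp add: set_eq_iff)

lemma defP_inj_on [dintros]:
  "defP (\<lambda>s. \<forall>x. x \<in> A s \<longrightarrow> (\<forall>y. y \<in> A s \<longrightarrow> F x s = F y s \<longrightarrow> x = y)) \<Longrightarrow>
   defP (\<lambda>s. inj_on (\<lambda>x. F x s) (A s))"
  by (simp add: inj_on_def Ball_def)

lemma elts_inject [simp]: "elts a = elts b \<longleftrightarrow> a = b" for a b :: "'v::zfc_model"
  using zfc_extensionality by auto

text \<open>
  If \<open>A s\<close> is not the extension of a set, \<open>vset (A s)\<close> is the junk value \<open>THE a. False\<close>,
  which is a mere parameter.
\<close>

lemma defT_vset [dintros]:
  assumes "defP (\<lambda>s. s 0 \<in> A (\<lambda>n. s (Suc n)))" shows "defT (\<lambda>s. vset (A s))"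
proof -
  have *: "b = vset B \<longleftrightarrow> elts b = B \<or> (\<not> (\<exists>c. elts c = B)) \<and> b = (THE a. False)" for b and B :: "'a set"
  proof (cases "\<exists>c. elts c = B")
    case True
    then show ?thesis by (auto simp: vset_def)
  next
    case False
    then have "vset B = (THE a. False)" by (auto simp: vset_def)
    with False show ?thesis by auto
  qed
  have A: "defP (\<lambda>s. s 0 \<in> A (\<lambda>n. s (Suc (Suc n))))"
    using defP_skip[OF assms] by simp
  have B: "defP (\<lambda>s. s 0 \<in> A (\<lambda>n. s (Suc (Suc (Suc n)))))"
    using defP_skip[OF A] by simp
  show ?thesis
    unfolding defT_def * by (intro dintros) (use A B in simp_all)
qed

lemma defT_If [dintros]:
  assumes "defP P" "defT a" "defT b" shows "defT (\<lambda>s. if P s then a s else b s)"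
proof -
  have "(\<lambda>s. s 0 = (if P (\<lambda>n. s (Suc n)) then a (\<lambda>n. s (Suc n)) else b (\<lambda>n. s (Suc n)))) =
    (\<lambda>s. (P (\<lambda>n. s (Suc n)) \<longrightarrow> s 0 = a (\<lambda>n. s (Suc n))) \<and>
      (\<not> P (\<lambda>n. s (Suc n)) \<longrightarrow> s 0 = b (\<lambda>n. s (Suc n))))"
    by auto
  then show ?thesis
    unfolding defT_def
    by (simp only:) (intro dintros defP_shift defT_shift assms)
qed

lemma is_class_iff: "is_class X \<longleftrightarrow> defP1 (\<lambda>x. x \<in> X)"
proof
  assume "is_class X"
  then obtain p s where p: "X = {x. sat mem (s(0 := x)) p}" unfolding is_class_def by blast
  \<comment> \<open>Variable 0 remains the argument; all others are parameters and move to the odd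
    slots.\<close>
  let ?f = "case_nat 0 (\<lambda>n. Suc (2 * n))"
  show "defP1 (\<lambda>x. x \<in> X)"
    unfolding defP1_def
  proof (rule defPI)
    show "inj ?f" by (auto simp: inj_def split: nat.split)
    show "interleave s' (\<lambda>n. s (Suc n)) (?f n) = (s(0 := s' 0)) n" for s' n
      by (simp split: nat.split)
    show "(s' 0 \<in> X) = sat mem (s(0 := s' 0)) p" for s' by (simp add: p)
  qed
next
  assume "defP1 (\<lambda>x. x \<in> X)"
  then obtain p t where p: "\<And>s. s 0 \<in> X \<longleftrightarrow> sat mem (interleave s t) p"
    unfolding defP1_def defP_def by blast
  \<comment> \<open>Membership of \<open>s 0\<close> does not depend on the other arguments, so
    these can be fixed arbitrarily and counted as parameters.\<close>
  have "interleave ((\<lambda>_. undefined)(0 := x)) t = (interleave (\<lambda>_. undefined) t)(0 := x)" for x :: 'a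
    by (auto simp: interleave_def fun_eq_iff elim!: oddE evenE)
  then have "X = {x. sat mem ((interleave (\<lambda>_. undefined) t)(0 := x)) p}"
    using p[of "(\<lambda>_. undefined)(0 := _)"] by auto
  then show "is_class X" unfolding is_class_def by blast
qed

lemmas is_classD = defP1D[OF is_class_iff[THEN iffD1]]

lemma is_classI: "defP (\<lambda>s. s 0 \<in> X) \<Longrightarrow> is_class X"
  by (simp add: is_class_iff defP1_def)

section \<open>Collections that are extensions of sets of the model\<close>

definition small :: "'v::zfc_model set \<Rightarrow> bool" where "small A \<longleftrightarrow> (\<exists>a. elts a = A)"

lemma small_elts [simp, intro]: "small (elts a)"
  by (auto simp: small_def)

lemma elts_vset [simp]: "small A \<Longrightarrow> elts (vset A) = A"
  by (auto simp: small_def vset_def)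

lemma vset_elts [simp]: "vset (elts a) = a"
  by (simp add: vset_def)

lemma small_Collect:
  assumes "small A" "defP (\<lambda>s. P (s 0))" shows "small {x \<in> A. P x}"
proof -
  obtain a where a: "elts a = A" using assms(1) by (auto simp: small_def)
  have "is_class {x. P x}" using assms(2) by (intro is_classI) simp
  then obtain p s where "{x. P x} = {x. sat mem (s(0 := x)) p}" unfolding is_class_def by blast
  then have "{x \<in> A. P x} = {x \<in> elts a. sat mem (s(0 := x)) p}" using a by auto
  with zfc_separation[of a s p] show ?thesis by (simp add: small_def)
qed

text \<open>Inclusion in a set is not enough, since only definable subcollections are guaranteed by
  separation.\<close>

lemma small_subset:
  assumes "small A" "B \<subseteq> A" "defP (\<lambda>s. s 0 \<in> B)" shows "small B"
proof -
  have "B = {x \<in> A. x \<in> B}" using assms by auto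
  then show ?thesis using small_Collect[OF assms(1,3)] by simp
qed

lemma small_image:
  assumes "small A" "defT (\<lambda>s. F (s 0))" shows "small (F ` A)"
proof -
  obtain a where a: "elts a = A" using assms(1) by (auto simp: small_def)
  have "defP (\<lambda>s. s (Suc 0) = F (s 0))"
    by (intro dintros assms)
  then obtain p t where p: "\<And>s. s (Suc 0) = F (s 0) \<longleftrightarrow> sat mem (interleave s t) p"
    unfolding defP_def by blast
  \<comment> \<open>Replacement expects the value in variable 1, but the second argument sits in
    variable 2, the second even slot; the two variables are exchanged.\<close>
  let ?f = "\<lambda>n::nat. if n = 2 then 1 else if n = 1 then 2 else n"
  let ?s = "\<lambda>x y. (\<lambda>_::nat. undefined)(0 := x, Suc 0 := y)"
  let ?t = "\<lambda>n. interleave (?s undefined undefined) t (?f n)"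
  have f: "inj ?f" by (auto simp: inj_def)
  have "(\<lambda>n. (?t(0 := x, 1 := y)) (?f n)) = interleave (?s x y) t" for x y
  proof
    fix n show "(?t(0 := x, 1 := y)) (?f n) = interleave (?s x y) t n"
    proof (cases "n = 0 \<or> n = 1 \<or> n = 2")
      case True
      then show ?thesis by (auto simp: interleave_def)
    next
      case False
      then have "even n \<Longrightarrow> n div 2 \<noteq> 0 \<and> n div 2 \<noteq> Suc 0" by presburger
      with False show ?thesis by (auto simp: interleave_def)
    qed
  qed
  then have s: "sat mem (?t(0 := x, 1 := y)) (ren ?f p) \<longleftrightarrow> y = F x" for x y
    using p[of "?s x y"] by (simp add: sat_ren[OF f] del: fun_upd_apply) simp
  have "\<exists>b. elts b = {y. \<exists>x\<in>elts a. y = F x}"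
    using zfc_replacement[of a ?t "ren ?f p"] unfolding s by blast
  moreover have "{y. \<exists>x\<in>elts a. y = F x} = F ` A" using a by auto
  ultimately show ?thesis by (simp add: small_def)
qed

lemma small_doubleton [simp, intro]: "small {a, b}"
  using zfc_pairing by (auto simp: small_def)

lemma small_singleton [simp, intro]: "small {a}"
  using small_doubleton[of a a] by simp

lemma small_empty [simp, intro]: "small {}"
  using small_Collect[of "{undefined}" "\<lambda>x. False"] by (simp add: dintros)

lemma small_UN_elts: "small A \<Longrightarrow> small (\<Union> (elts ` A))"
  using zfc_union by (auto simp: small_def)

lemma small_Un [intro]: "small A \<Longrightarrow> small B \<Longrightarrow> small (A \<union> B)"
  using small_UN_elts[of "{vset A, vset B}"] by simp

lemma small_insert [intro]: "small A \<Longrightarrow> small (insert a A)"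
  using small_Un[of "{a}" A] by simp

lemma small_Pow: "small A \<Longrightarrow> small {b. elts b \<subseteq> A}"
  using zfc_power_set by (auto simp: small_def)

lemma small_Int_elts [intro]: "small A \<Longrightarrow> small (A \<inter> elts b)"
  by (rule small_subset[where A = A]) (auto simp: small_def intro!: dintros)

lemma small_Diff_elts [intro]: "small A \<Longrightarrow> small (A - elts b)"
  by (rule small_subset[where A = A]) (auto simp: small_def intro!: dintros)

lemma small_Int [intro]: "small A \<Longrightarrow> small B \<Longrightarrow> small (A \<inter> B)"
  and small_Diff [intro]: "small A \<Longrightarrow> small B \<Longrightarrow> small (A - B)"
  using small_Int_elts[of A "vset B"] small_Diff_elts[of A "vset B"] by simp_all

section \<open>Set functions and recursion\<close>

lemma defP_vsubset [dintros]: "defT a \<Longrightarrow> defT b \<Longrightarrow> defP (\<lambda>s. vsubset (a s) (b s))"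
  by (rule defP2D[where P = vsubset]) (simp add: defP2_def vsubset_def, intro dintros)

lemma defT_vdiff [dintros]: "defT a \<Longrightarrow> defT b \<Longrightarrow> defT (\<lambda>s. vdiff (a s) (b s))"
  by (rule defT2D[where P = vdiff]) (simp add: defT2_def vdiff_def, intro dintros)

lemma defT_vpair [dintros]: "defT a \<Longrightarrow> defT b \<Longrightarrow> defT (\<lambda>s. vpair (a s) (b s))"
  by (rule defT2D[where P = vpair]) (simp add: defT2_def vpair_def, intro dintros)

lemma elts_vdiff [simp]: "elts (vdiff a b) = elts a - elts b"
  unfolding vdiff_def by (intro elts_vset small_Diff_elts small_elts)

lemma vset_inject: "small A \<Longrightarrow> small B \<Longrightarrow> vset A = vset B \<longleftrightarrow> A = B"
  by (metis elts_vset)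

lemma vpair_inject [simp]: "vpair a b = vpair c d \<longleftrightarrow> a = c \<and> b = d"
  unfolding vpair_def by (auto simp: vset_inject doubleton_eq_iff)

definition graph :: "('v::zfc_model \<Rightarrow> 'v) \<Rightarrow> 'v \<Rightarrow> 'v" where
  "graph F a = vset ((\<lambda>x. vpair x (F x)) ` elts a)"

text \<open>
  Application of a set of pairs, written as a union of values in order to be definable without
  a description operator.
\<close>

definition app :: "'v::zfc_model \<Rightarrow> 'v \<Rightarrow> 'v" where
  "app f x = vset {u. \<exists>v. vpair x v \<in> elts f \<and> u \<in> elts v}"

lemma defT_app [dintros]: "defT a \<Longrightarrow> defT b \<Longrightarrow> defT (\<lambda>s. app (a s) (b s))"
  by (rule defT2D[where P = app]) (simp add: defT2_def app_def, intro dintros)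

lemma defT1I: "defT (\<lambda>s. F (s 0)) \<Longrightarrow> defT1 F"
  by (simp add: defT1_def)

lemma defT1_app [simp]: "defT1 (app f)"
  by (intro defT1I dintros)

lemma defT_graph:
  assumes "defT1 F" "defT a" shows "defT (\<lambda>s. graph F (a s))"
  by (rule defT1D[where G = "graph F", OF _ assms(2)], unfold graph_def)
    (intro defT1I dintros defT1D[OF assms(1)])

lemma defT_graph_app [dintros]:
  "defT f \<Longrightarrow> defT a \<Longrightarrow> defT (\<lambda>s. graph (app (f s)) (a s))"
  by (rule defT2D[where P = "\<lambda>f. graph (app f)"]) (simp add: defT2_def graph_def, intro dintros)

lemma small_defT1: "small A \<Longrightarrow> defT1 F \<Longrightarrow> small (F ` A)"
  by (simp add: small_image defT1_def)

lemma elts_graph: "defT1 F \<Longrightarrow> elts (graph F a) = (\<lambda>x. vpair x (F x)) ` elts a"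
  unfolding graph_def
  by (intro elts_vset small_image small_elts dintros defT1D[where G = F])

lemma graph_cong: "(\<And>x. x \<in> elts a \<Longrightarrow> F x = F' x) \<Longrightarrow> graph F a = graph F' a"
  unfolding graph_def by (auto intro!: arg_cong[of _ _ vset])

lemma app_eq:
  assumes "elts f = (\<lambda>x. vpair x (F x)) ` A" "x \<in> A" shows "app f x = F x"
proof -
  have "{u. \<exists>v. vpair x v \<in> elts f \<and> u \<in> elts v} = elts (F x)"
    using assms by auto
  then show ?thesis by (simp add: app_def)
qed

lemma app_graph [simp]: "defT1 F \<Longrightarrow> x \<in> elts a \<Longrightarrow> app (graph F a) x = F x"
  by (rule app_eq[OF elts_graph])

lemma set_function_defT1: "defT1 F \<Longrightarrow> set_function F a"
  unfolding set_function_def using elts_graph by blast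

lemma set_functionE:
  assumes "set_function F a" obtains f where "\<And>x. x \<in> elts a \<Longrightarrow> app f x = F x"
  using assms app_eq unfolding set_function_def by metis

text \<open>Trades the quantifier over HOL functions for one over sets of the model, which is what
  makes \<open>card_le\<close> definable.\<close>

lemma card_le_app:
  "card_le a b \<longleftrightarrow> (\<exists>f. inj_on (app f) (elts a) \<and> app f ` elts a \<subseteq> elts b)"
proof
  assume "card_le a b"
  then obtain F where F: "set_function F a" "inj_on F (elts a)" "F ` elts a \<subseteq> elts b"
    unfolding card_le_def by blast
  then obtain f where f: "\<And>x. x \<in> elts a \<Longrightarrow> app f x = F x" using set_functionE by blast
  with F have "inj_on (app f) (elts a)" "app f ` elts a \<subseteq> elts b"
    by (auto simp: inj_on_def)
  then show "\<exists>f. inj_on (app f) (elts a) \<and> app f ` elts a \<subseteq> elts b" by blast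
next
  assume "\<exists>f. inj_on (app f) (elts a) \<and> app f ` elts a \<subseteq> elts b"
  then show "card_le a b" unfolding card_le_def using set_function_defT1[OF defT1_app] by blast
qed

lemma card_leI: "defT1 F \<Longrightarrow> inj_on F (elts a) \<Longrightarrow> F ` elts a \<subseteq> elts b \<Longrightarrow> card_le a b"
  unfolding card_le_def using set_function_defT1 by blast

lemma card_leE:
  assumes "card_le a b"
  obtains F where "defT1 F" "inj_on F (elts a)" "F ` elts a \<subseteq> elts b"
  using assms defT1_app unfolding card_le_app by blast

lemma defP_card_le [dintros]: "defT a \<Longrightarrow> defT b \<Longrightarrow> defP (\<lambda>s. card_le (a s) (b s))"
  by (rule defP2D[where P = card_le]) (simp add: defP2_def card_le_app, intro dintros)

lemma defP_card_less [dintros]: "defT a \<Longrightarrow> defT b \<Longrightarrow> defP (\<lambda>s. card_less (a s) (b s))"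
  unfolding card_less_def by (intro dintros)

lemma defT1_comp: "defT1 F \<Longrightarrow> defT1 G \<Longrightarrow> defT1 (\<lambda>x. F (G x))"
  unfolding defT1_def[of "\<lambda>x. F (G x)"] by (intro defT1D[of F] defT1D[of G] dintros)

lemma defT1_id [simp]: "defT1 (\<lambda>x. x)"
  by (intro defT1I dintros)

lemma card_le_trans:
  assumes "card_le a b" "card_le b c" shows "card_le a c"
proof -
  obtain F where F: "defT1 F" "inj_on F (elts a)" "F ` elts a \<subseteq> elts b"
    using assms(1) by (rule card_leE)
  obtain G where G: "defT1 G" "inj_on G (elts b)" "G ` elts b \<subseteq> elts c"
    using assms(2) by (rule card_leE)
  have "inj_on (G \<circ> F) (elts a)"
    using F G by (meson comp_inj_on inj_on_subset)
  with F(3) G(3) show ?thesis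
    using card_leI[OF defT1_comp[OF G(1) F(1)], of a c] by (auto simp: comp_def)
qed

lemma card_le_subset: "elts a \<subseteq> elts b \<Longrightarrow> card_le a b"
  by (rule card_leI[of "\<lambda>x. x"]) auto

section \<open>Foundation and recursion on membership\<close>

lemma foundation:
  assumes "small A" "A \<noteq> {}" obtains x where "x \<in> A" "elts x \<inter> A = {}"
  using zfc_foundation[of "vset A"] assms by (metis elts_vset)

definition trans_set :: "'v::zfc_model \<Rightarrow> bool" where
  "trans_set t \<longleftrightarrow> (\<forall>x\<in>elts t. elts x \<subseteq> elts t)"

lemma trans_setD: "trans_set t \<Longrightarrow> x \<in> elts t \<Longrightarrow> y \<in> elts x \<Longrightarrow> y \<in> elts t"
  by (auto simp: trans_set_def)

text \<open>Foundation speaks of sets only, so the counterexamples are collected inside a transitive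
  set. Transitive closures are not yet available: they are themselves obtained from the recursion
  built here.\<close>

lemma trans_set_induct:
  assumes "trans_set t" "x \<in> elts t" "defP (\<lambda>s. P (s 0))"
    and step: "\<And>x. x \<in> elts t \<Longrightarrow> (\<And>y. y \<in> elts x \<Longrightarrow> P y) \<Longrightarrow> P x"
  shows "P x"
proof (rule ccontr)
  assume "\<not> P x"
  let ?A = "{x \<in> elts t. \<not> P x}"
  have "small ?A" by (intro small_Collect small_elts dintros assms)
  moreover have "?A \<noteq> {}" using assms(2) \<open>\<not> P x\<close> by blast
  ultimately obtain z where "z \<in> ?A" "elts z \<inter> ?A = {}" by (rule foundation)
  then have "z \<in> elts t" "\<not> P z" "\<And>y. y \<in> elts z \<Longrightarrow> P y"
    using trans_setD[OF assms(1), of z] by auto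
  with step[of z] show False by simp
qed

definition attempt :: "('v::zfc_model \<Rightarrow> 'v) \<Rightarrow> 'v \<Rightarrow> 'v \<Rightarrow> bool" where
  "attempt G f t \<longleftrightarrow> trans_set t \<and> (\<forall>z\<in>elts t. app f z = G (graph (app f) z))"

text \<open>All attempts defined at \<open>x\<close> agree there, so the union of their values is
  the common value; as with \<open>app\<close>, this form is visibly definable.\<close>

definition eps_rec :: "('v::zfc_model \<Rightarrow> 'v) \<Rightarrow> 'v \<Rightarrow> 'v" where
  "eps_rec G x = vset {u. \<exists>f t. attempt G f t \<and> x \<in> elts t \<and> u \<in> elts (app f x)}"

lemma defP_attempt:
  assumes "defT1 G" "defT f" "defT t" shows "defP (\<lambda>s. attempt G (f s) (t s))"
  by (rule defP2D[where P = "attempt G", OF _ assms(2,3)])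
    (simp add: defP2_def attempt_def trans_set_def, intro dintros defT1D[OF assms(1)])

lemma defT1_eps_rec: assumes "defT1 G" shows "defT1 (eps_rec G)"
  unfolding eps_rec_def by (intro defT1I dintros defP_attempt[OF assms])

lemma attempt_unique:
  assumes "attempt G f t" "attempt G g u" "x \<in> elts t" "x \<in> elts u"
  shows "app f x = app g x"
proof -
  have "x \<in> elts u \<longrightarrow> app f x = app g x"
  proof (rule trans_set_induct[where t = t and P = "\<lambda>x. x \<in> elts u \<longrightarrow> app f x = app g x"])
    show "defP (\<lambda>s. s 0 \<in> elts u \<longrightarrow> app f (s 0) = app g (s 0))" by (intro dintros)
    fix z assume z: "z \<in> elts t" "\<And>y. y \<in> elts z \<Longrightarrow> y \<in> elts u \<longrightarrow> app f y = app g y"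
    show "z \<in> elts u \<longrightarrow> app f z = app g z"
    proof
      assume "z \<in> elts u"
      then have "graph (app f) z = graph (app g) z"
        using assms(2) z(2) by (intro graph_cong) (auto simp: attempt_def dest: trans_setD)
      with \<open>z \<in> elts u\<close> z(1) assms(1,2) show "app f z = app g z" by (simp add: attempt_def)
    qed
  qed (use assms in \<open>simp_all add: attempt_def\<close>)
  with assms(4) show ?thesis by blast
qed

lemma eps_rec_attempt:
  assumes "attempt G f t" "x \<in> elts t" shows "eps_rec G x = app f x"
proof -
  have "(\<exists>g t. attempt G g t \<and> x \<in> elts t \<and> u \<in> elts (app g x)) \<longleftrightarrow> u \<in> elts (app f x)" for u
    using assms by (metis (no_types) attempt_unique)
  then have "{u. \<exists>g t. attempt G g t \<and> x \<in> elts t \<and> u \<in> elts (app g x)} = elts (app f x)"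
    by simp
  then show ?thesis by (simp add: eps_rec_def)
qed

lemma eps_rec_attempt':
  assumes "attempt G f t" "x \<in> elts t" shows "eps_rec G x = G (graph (eps_rec G) x)"
proof -
  have "graph (eps_rec G) x = graph (app f) x"
    using assms eps_rec_attempt[OF assms(1)]
    by (intro graph_cong) (auto simp: attempt_def dest: trans_setD)
  with assms eps_rec_attempt[OF assms] show ?thesis by (simp add: attempt_def)
qed

text \<open>If every element of \<open>x\<close> has an attempt but \<open>x\<close> has none, the
  points of \<open>t\<close> with an attempt, together with \<open>x\<close>, form a transitive set
  that carries one.\<close>

lemma attempt_exists:
  assumes G: "defT1 G" and "trans_set t" "x \<in> elts t"
  shows "\<exists>f u. attempt G f u \<and> x \<in> elts u"
proof (rule trans_set_induct[OF assms(2,3), where P = "\<lambda>x. \<exists>f u. attempt G f u \<and> x \<in> elts u"])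
  let ?P = "\<lambda>x. \<exists>f u. attempt G f u \<and> x \<in> elts u"
  show "defP (\<lambda>s. ?P (s 0))" by (intro dintros defP_attempt[OF G])
  then have small: "small {y \<in> elts t. ?P y}" by (intro small_Collect small_elts)
  fix x assume x: "x \<in> elts t" "\<And>y. y \<in> elts x \<Longrightarrow> ?P y"
  show "?P x"
  proof (rule ccontr)
    assume "\<not> ?P x"
    define u where "u = vset (insert x {y \<in> elts t. ?P y})"
    \<comment> \<open>\<open>eps_rec G\<close> already satisfies the recursion wherever an attempt
      exists, so it serves as the glued function; only its value at \<open>x\<close> has to be
      prescribed.\<close>
    define F where "F z = (if z = x then G (graph (eps_rec G) x) else eps_rec G z)" for z
    have u: "elts u = insert x {y \<in> elts t. ?P y}"
      unfolding u_def using small by (intro elts_vset) auto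
    have F: "defT1 F" unfolding F_def
      by (intro defT1I dintros defT1D[OF G] defT_graph[OF defT1_eps_rec[OF G]]
          defT1D[OF defT1_eps_rec[OF G]])
    have below: "y \<in> {y \<in> elts t. ?P y} \<and> y \<noteq> x" if "z \<in> elts u" "y \<in> elts z" for y z
    proof (cases "z = x")
      case True
      with x \<open>\<not> ?P x\<close> \<open>trans_set t\<close> that show ?thesis by (auto dest: trans_setD)
    next
      case False
      with that u obtain f w where w: "attempt G f w" "z \<in> elts w" "z \<in> elts t" by blast
      then have "y \<in> elts w" using that by (auto simp: attempt_def dest: trans_setD)
      with w that \<open>\<not> ?P x\<close> \<open>trans_set t\<close> show ?thesis by (auto dest: trans_setD)
    qed
    have "attempt G (graph F u) u"
      unfolding attempt_def
    proof (intro conjI ballI)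
      show "trans_set u"
        unfolding trans_set_def
      proof (intro ballI subsetI)
        fix z y assume "z \<in> elts u" "y \<in> elts z"
        from below[OF this] show "y \<in> elts u" unfolding u by (rule insertI2[OF conjunct1])
      qed
      fix z assume z: "z \<in> elts u"
      have "graph (app (graph F u)) z = graph (eps_rec G) z"
      proof (rule graph_cong)
        fix y assume "y \<in> elts z"
        with below[OF z this] u have "y \<in> elts u" "y \<noteq> x" by auto
        then show "app (graph F u) y = eps_rec G y" using F by (simp add: F_def)
      qed
      moreover have "F z = G (graph (eps_rec G) z)"
      proof (cases "z = x")
        case False
        with z u obtain f w where "attempt G f w" "z \<in> elts w" by blast
        with False show ?thesis by (simp add: F_def eps_rec_attempt'[symmetric])
      qed (simp add: F_def)
      ultimately show "app (graph F u) z = G (graph (app (graph F u)) z)" using F z by simp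
    qed
    moreover have "x \<in> elts u" by (simp add: u)
    ultimately have "?P x" by (intro exI conjI)
    with \<open>\<not> ?P x\<close> show False ..
  qed
qed

lemma eps_rec_eq:
  assumes "defT1 G" "trans_set t" "x \<in> elts t" shows "eps_rec G x = G (graph (eps_rec G) x)"
  using attempt_exists[OF assms] eps_rec_attempt' by blast

section \<open>Collection and choice for classes\<close>

lemma elts_vset_image [simp]: "defT1 F \<Longrightarrow> elts (vset (F ` elts a)) = F ` elts a"
  by (simp add: small_defT1)

lemma small_UN: "small A \<Longrightarrow> defT1 F \<Longrightarrow> small (\<Union>x\<in>A. elts (F x))"
  using small_UN_elts[OF small_defT1, of A F] by (simp add: image_image)

locale regular =
  fixes \<kappa> :: "'v::zfc_model"
  assumes reg: "regular_cardinal \<kappa>" and omega_in: "omega \<in> elts \<kappa>"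
begin

lemma ord: "ordinal \<kappa>"
  using reg by (simp add: regular_cardinal_def cardinal_def)

lemma trans_kappa: "trans_set \<kappa>"
  using ord by (simp add: ordinal_def trans_set_def)

lemma kappa_down: "\<alpha> \<in> elts \<kappa> \<Longrightarrow> \<beta> \<in> elts \<alpha> \<Longrightarrow> \<beta> \<in> elts \<kappa>"
  using trans_kappa by (rule trans_setD)

lemma kappa_irrefl: "\<alpha> \<in> elts \<kappa> \<Longrightarrow> \<alpha> \<notin> elts \<alpha>"
  using ord by (simp add: ordinal_def)

lemma kappa_trans: "\<gamma> \<in> elts \<kappa> \<Longrightarrow> \<alpha> \<in> elts \<beta> \<Longrightarrow> \<beta> \<in> elts \<gamma> \<Longrightarrow> \<alpha> \<in> elts \<gamma>"
  using ord kappa_down unfolding ordinal_def by meson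

lemma kappa_linear:
  assumes "\<alpha> \<in> elts \<kappa>" "\<beta> \<in> elts \<kappa>" shows "\<alpha> \<in> elts \<beta> \<or> \<alpha> = \<beta> \<or> \<beta> \<in> elts \<alpha>"
proof -
  have "elts (vset {\<alpha>, \<beta>}) \<subseteq> elts \<kappa> \<and> elts (vset {\<alpha>, \<beta>}) \<noteq> {}" using assms by simp
  then have "\<exists>x\<in>elts (vset {\<alpha>, \<beta>}). \<forall>y\<in>elts (vset {\<alpha>, \<beta>}). x = y \<or> x \<in> elts y"
    using ord unfolding ordinal_def by blast
  then show ?thesis by auto
qed

lemma kappa_regular:
  assumes "a \<in> elts \<kappa>" "defT1 F" "F ` elts a \<subseteq> elts \<kappa>"
  shows "\<exists>b\<in>elts \<kappa>. \<forall>x\<in>elts a. F x \<in> elts b"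
proof -
  have "\<not> (\<forall>b\<in>elts \<kappa>. \<exists>x\<in>elts a. b = F x \<or> b \<in> elts (F x))"
    using reg assms set_function_defT1[OF assms(2)] unfolding regular_cardinal_def by blast
  then obtain b where "b \<in> elts \<kappa>" "\<forall>x\<in>elts a. b \<noteq> F x \<and> b \<notin> elts (F x)" by blast
  moreover from this have "\<forall>x\<in>elts a. F x \<in> elts b"
    using kappa_linear assms(3) by blast
  ultimately show ?thesis by blast
qed

lemma empty_in_omega: "vset {} \<in> elts (omega :: 'v)"
proof -
  obtain w :: 'v where w: "infinity_set w" using zfc_infinity by blast
  have "small {n \<in> elts w. \<forall>w'. infinity_set w' \<longrightarrow> n \<in> elts w'}"
    unfolding infinity_set_def by (intro small_Collect small_elts dintros)
  also have "{n \<in> elts w. \<forall>w'. infinity_set w' \<longrightarrow> n \<in> elts w'} = {n. \<forall>w'. infinity_set w' \<longrightarrow> n \<in> elts w'}"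
    using w by blast
  finally have *: "elts (omega :: 'v) = {n. \<forall>w. infinity_set w \<longrightarrow> n \<in> elts w}"
    unfolding omega_def by (rule elts_vset)
  have "vset {} \<in> elts w" if "infinity_set w" for w :: 'v
    using that unfolding infinity_set_def by (metis vset_elts)
  then show ?thesis unfolding * by blast
qed

lemma empty_in: "vset {} \<in> elts \<kappa>"
  using empty_in_omega omega_in kappa_down by blast

text \<open>A constant function on \<open>omega\<close> is bounded in \<kappa> by regularity, and
  \<open>omega\<close> is nonempty; so \<kappa> has no largest element, without recourse to
  successors.\<close>

lemma kappa_limit:
  assumes "\<alpha> \<in> elts \<kappa>" shows "\<exists>\<beta>\<in>elts \<kappa>. \<alpha> \<in> elts \<beta>"
proof -
  have "\<exists>b\<in>elts \<kappa>. \<forall>x\<in>elts (omega :: 'v). \<alpha> \<in> elts b"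
    using kappa_regular[OF omega_in, of "\<lambda>_. \<alpha>"] assms
    by (simp add: defT1I defT_const image_subset_iff)
  then show ?thesis using empty_in_omega by blast
qed

text \<open>The usual iteration of unions, but along \<kappa> instead of \<open>omega\<close>: that
  \<kappa> is transitive permits the recursion, and that it has no largest element makes the result
  closed under membership.\<close>

lemma in_trans_set: "\<exists>t. trans_set t \<and> x \<in> elts t" for x :: 'v
proof -
  define G where "G h = vset ({x} \<union> {z. \<exists>\<beta> v y. vpair \<beta> v \<in> elts h \<and> y \<in> elts v \<and> z \<in> elts y})" for h
  have G: "defT1 G" unfolding G_def by (intro defT1I dintros)
  define F where "F = eps_rec G"
  have F: "defT1 F" unfolding F_def by (rule defT1_eps_rec[OF G])
  have elts_F: "elts (F \<alpha>) = {x} \<union> (\<Union>y\<in>(\<Union>\<beta>\<in>elts \<alpha>. elts (F \<beta>)). elts y)" if "\<alpha> \<in> elts \<kappa>" for \<alpha>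
  proof -
    have "{z. \<exists>\<beta> v y. vpair \<beta> v \<in> elts (graph F \<alpha>) \<and> y \<in> elts v \<and> z \<in> elts y} =
      (\<Union>y\<in>(\<Union>\<beta>\<in>elts \<alpha>. elts (F \<beta>)). elts y)"
      unfolding elts_graph[OF F] by (auto simp: image_iff)
    then have "F \<alpha> = vset ({x} \<union> (\<Union>y\<in>(\<Union>\<beta>\<in>elts \<alpha>. elts (F \<beta>)). elts y))"
      using eps_rec_eq[OF G trans_kappa that] by (simp add: G_def flip: F_def)
    moreover have "small ({x} \<union> (\<Union>y\<in>(\<Union>\<beta>\<in>elts \<alpha>. elts (F \<beta>)). elts y))"
      by (intro small_Un small_singleton small_UN_elts small_UN small_elts F)
    ultimately show ?thesis by (simp only: elts_vset)
  qed
  let ?t = "vset (\<Union>\<alpha>\<in>elts \<kappa>. elts (F \<alpha>))"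
  have t: "elts ?t = (\<Union>\<alpha>\<in>elts \<kappa>. elts (F \<alpha>))" by (simp add: small_UN F)
  have "trans_set ?t"
    unfolding trans_set_def t
  proof (intro ballI subsetI)
    fix y z assume "y \<in> (\<Union>\<alpha>\<in>elts \<kappa>. elts (F \<alpha>))" "z \<in> elts y"
    then obtain \<alpha> where \<alpha>: "\<alpha> \<in> elts \<kappa>" "y \<in> elts (F \<alpha>)" by blast
    then obtain \<beta> where "\<beta> \<in> elts \<kappa>" "\<alpha> \<in> elts \<beta>" using kappa_limit by blast
    with \<alpha> \<open>z \<in> elts y\<close> show "z \<in> (\<Union>\<alpha>\<in>elts \<kappa>. elts (F \<alpha>))" using elts_F by blast
  qed
  moreover have "x \<in> elts ?t" unfolding t using elts_F empty_in by blast
  ultimately show ?thesis by blast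
qed

lemma eps_rec: "defT1 G \<Longrightarrow> eps_rec G x = G (graph (eps_rec G) x)" for x :: 'v
  using in_trans_set eps_rec_eq by blast

lemma eps_induct:
  fixes x :: 'v
  assumes "defP (\<lambda>s. P (s 0))" and "\<And>x. (\<And>y. y \<in> elts x \<Longrightarrow> P y) \<Longrightarrow> P x"
  shows "P x"
  using in_trans_set[of x] trans_set_induct[of _ x P] assms by blast

text \<open>
  The level \<open>V\<^sub>\<rho>\<close> of the cumulative hierarchy, where \<open>\<rho>\<close> is the rank of the argument:
  this gives Scott's trick without a theory of ordinals.
\<close>

definition rank_level :: "'v \<Rightarrow> 'v" where
  "rank_level = eps_rec (\<lambda>h. vset {z. \<exists>y v. vpair y v \<in> elts h \<and> elts z \<subseteq> elts v})"

lemma defT1_rank_level: "defT1 rank_level"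
  unfolding rank_level_def by (intro defT1_eps_rec defT1I dintros)

lemma elts_rank_level: "elts (rank_level x) = {z. \<exists>y\<in>elts x. elts z \<subseteq> elts (rank_level y)}"
proof -
  let ?P = "\<lambda>y. vset {z. elts z \<subseteq> elts (rank_level y)}"
  have P: "defT1 ?P"
    by (intro defT1I dintros defT1D[OF defT1_rank_level])
  have G: "defT1 (\<lambda>h. vset {z. \<exists>y v. vpair y v \<in> elts h \<and> elts z \<subseteq> elts v})"
    by (intro defT1I dintros)
  have "rank_level x = vset {z. \<exists>y v. vpair y v \<in> elts (graph rank_level x) \<and> elts z \<subseteq> elts v}"
    unfolding rank_level_def by (rule eps_rec[OF G])
  also have "{z. \<exists>y v. vpair y v \<in> elts (graph rank_level x) \<and> elts z \<subseteq> elts v}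
      = {z. \<exists>y\<in>elts x. elts z \<subseteq> elts (rank_level y)}"
    unfolding elts_graph[OF defT1_rank_level] by (auto simp: image_iff)
  also have "\<dots> = (\<Union>y\<in>elts x. elts (?P y))" by (simp add: small_Pow) blast
  finally have "elts (rank_level x) = (\<Union>y\<in>elts x. elts (?P y))" using P by (simp add: small_UN)
  also have "\<dots> = {z. \<exists>y\<in>elts x. elts z \<subseteq> elts (rank_level y)}" by (simp add: small_Pow) blast
  finally show ?thesis .
qed

lemma subset_rank_level: "elts x \<subseteq> elts (rank_level x)"
proof (rule eps_induct[where P = "\<lambda>x. elts x \<subseteq> elts (rank_level x)"])
  show "defP (\<lambda>s. elts (s 0) \<subseteq> elts (rank_level (s 0)))"
    by (intro dintros defT1D[OF defT1_rank_level])
qed (use elts_rank_level in blast)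

text \<open>Comparability of ranks, stated for the levels. A set in the first level but not in the
  second is a subset of the level of some \<open>x' \<in> x\<close>, and the induction hypothesis
  then puts the whole second level inside that of \<open>x'\<close>.\<close>

lemma rank_level_linear: "elts (rank_level x) \<subseteq> elts (rank_level y) \<or> rank_level y \<in> elts (rank_level x)"
proof -
  have "\<forall>y. elts (rank_level x) \<subseteq> elts (rank_level y) \<or> rank_level y \<in> elts (rank_level x)"
  proof (rule eps_induct[where P = "\<lambda>x. \<forall>y. elts (rank_level x) \<subseteq> elts (rank_level y) \<or> rank_level y \<in> elts (rank_level x)"])
    show "defP (\<lambda>s. \<forall>y. elts (rank_level (s 0)) \<subseteq> elts (rank_level y) \<or> rank_level y \<in> elts (rank_level (s 0)))"
      by (intro dintros defT1D[OF defT1_rank_level])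
    fix x assume IH: "\<And>x'. x' \<in> elts x \<Longrightarrow> \<forall>y. elts (rank_level x') \<subseteq> elts (rank_level y) \<or> rank_level y \<in> elts (rank_level x')"
    show "\<forall>y. elts (rank_level x) \<subseteq> elts (rank_level y) \<or> rank_level y \<in> elts (rank_level x)"
    proof (intro allI, subst disj_commute, rule disjCI)
      fix y assume "\<not> elts (rank_level x) \<subseteq> elts (rank_level y)"
      then obtain x' z where x': "x' \<in> elts x" "elts z \<subseteq> elts (rank_level x')" "z \<notin> elts (rank_level y)"
        unfolding elts_rank_level[of x] by blast
      have "elts (rank_level y) \<subseteq> elts (rank_level x')"
      proof
        fix w assume "w \<in> elts (rank_level y)"
        then obtain y' where y': "y' \<in> elts y" "elts w \<subseteq> elts (rank_level y')"
          unfolding elts_rank_level[of y] by blast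
        then have "\<not> elts (rank_level x') \<subseteq> elts (rank_level y')"
          using x' unfolding elts_rank_level[of y] by blast
        then have "rank_level y' \<in> elts (rank_level x')" using IH x' by blast
        then show "w \<in> elts (rank_level x')" using y'(2) unfolding elts_rank_level[of x'] by blast
      qed
      then show "rank_level y \<in> elts (rank_level x)" unfolding elts_rank_level[of x] using x'(1) by blast
    qed
  qed
  then show ?thesis by blast
qed

text \<open>A level not included in another has that other one as an element, so induction on
  membership, applied to the levels themselves, yields a least one.\<close>

lemma minimal_rank:
  assumes "defP (\<lambda>s. P (s 0))" "P y"
  shows "\<exists>m. P m \<and> (\<forall>y. P y \<longrightarrow> elts (rank_level m) \<subseteq> elts (rank_level y))"
proof -
  let ?Q = "\<exists>m. P m \<and> (\<forall>y. P y \<longrightarrow> elts (rank_level m) \<subseteq> elts (rank_level y))"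
  have "\<forall>y. P y \<and> rank_level y = r \<longrightarrow> ?Q" for r
  proof (rule eps_induct[where P = "\<lambda>r. \<forall>y. P y \<and> rank_level y = r \<longrightarrow> ?Q"])
    show "defP (\<lambda>s. \<forall>y. P y \<and> rank_level y = s 0 \<longrightarrow> ?Q)"
      by (intro dintros defT1D[OF defT1_rank_level] defP1D[OF assms(1)[folded defP1_def]])
  qed (use rank_level_linear in blast)
  with assms(2) show ?Q by blast
qed

text \<open>The witnesses of least rank form a set, because each of them is a subset of the level of
  any other.\<close>

lemma collection:
  assumes "small A" and Q: "defP2 Q" and "\<And>x. x \<in> A \<Longrightarrow> \<exists>y. Q x y"
  shows "\<exists>b. \<forall>x\<in>A. \<exists>y\<in>elts b. Q x (y :: 'v)"
proof -
  let ?M = "\<lambda>x. {y. Q x y \<and> (\<forall>z. Q x z \<longrightarrow> elts (rank_level y) \<subseteq> elts (rank_level z))}"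
  have defM: "defT1 (\<lambda>x. vset (?M x))"
    by (intro defT1I dintros defP2D[OF Q] defT1D[OF defT1_rank_level])
  have small_M: "small (?M x) \<and> ?M x \<noteq> {}" if x: "x \<in> A" for x
  proof -
    have Qx: "defP (\<lambda>s. Q x (s 0))" by (intro defP2D[OF Q] dintros)
    obtain y where "Q x y" using assms(3)[OF x] by blast
    then obtain m where m: "Q x m" "\<And>y. Q x y \<Longrightarrow> elts (rank_level m) \<subseteq> elts (rank_level y)"
      using minimal_rank[of "Q x", OF Qx] by blast
    have "?M x \<subseteq> {y. elts y \<subseteq> elts (rank_level m)}" using subset_rank_level m(1) by blast
    then have "small (?M x)"
      by (rule small_subset[OF small_Pow[OF small_elts]])
        (intro dintros defP2D[OF Q] defT1D[OF defT1_rank_level])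
    with m show ?thesis by blast
  qed
  have b: "elts (vset (\<Union>x\<in>A. elts (vset (?M x)))) = (\<Union>x\<in>A. elts (vset (?M x)))"
    by (intro elts_vset small_UN[OF assms(1) defM])
  have "\<exists>y\<in>(\<Union>x\<in>A. elts (vset (?M x))). Q x y" if x: "x \<in> A" for x
  proof -
    obtain y where "y \<in> elts (vset (?M x))" "Q x y" using small_M[OF x] by auto
    then show ?thesis using x by blast
  qed
  then have "\<forall>x\<in>A. \<exists>y\<in>elts (vset (\<Union>x\<in>A. elts (vset (?M x)))). Q x y"
    unfolding b ..
  then show ?thesis ..
qed

text \<open>Collection bounds the witnesses, and tagging them with \<open>x\<close> makes the
  families disjoint, as the axiom of choice demands. The selector is definable from the transversal,
  so it can be used in replacement in its turn.\<close>

lemma class_choice: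
  assumes "small A" and Q: "defP2 Q" and ex: "\<And>x. x \<in> A \<Longrightarrow> \<exists>y. Q x y"
  shows "\<exists>F. defT1 F \<and> (\<forall>x\<in>A. Q x (F x :: 'v))"
proof -
  obtain b where b: "\<forall>x\<in>A. \<exists>y\<in>elts b. Q x y"
    using collection[OF assms] ..
  let ?E = "\<lambda>x. vset ((\<lambda>y. vpair x y) ` {y \<in> elts b. Q x y})"
  have E: "elts (?E x) = (\<lambda>y. vpair x y) ` {y \<in> elts b. Q x y}" for x
    by (intro elts_vset small_image small_Collect small_elts dintros defP2D[OF Q])
  have defE: "defT1 ?E" by (intro defT1I dintros defP2D[OF Q])
  let ?a = "vset (?E ` A)"
  have a: "elts ?a = ?E ` A" by (intro elts_vset small_defT1 assms defE)
  have "\<exists>c. \<forall>x\<in>elts ?a. \<exists>!z. z \<in> elts x \<inter> elts c"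
  proof (rule zfc_choice)
    show "\<forall>x\<in>elts ?a. elts x \<noteq> {}" using b by (auto simp: a E)
    show "\<forall>x\<in>elts ?a. \<forall>y\<in>elts ?a. x \<noteq> y \<longrightarrow> elts x \<inter> elts y = {}"
      unfolding a
    proof (intro ballI impI)
      fix p q assume "p \<in> ?E ` A" "q \<in> ?E ` A" "p \<noteq> q"
      then obtain x y where "p = ?E x" "q = ?E y" "x \<noteq> y" by blast
      then show "elts p \<inter> elts q = {}" by (auto simp: E)
    qed
  qed
  then obtain c where c: "\<And>x. x \<in> A \<Longrightarrow> \<exists>!z. z \<in> elts (?E x) \<inter> elts c"
    unfolding a by blast
  define F where "F x = vset {u. \<exists>y\<in>elts b. Q x y \<and> vpair x y \<in> elts c \<and> u \<in> elts y}" for x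
  have "defT1 F" unfolding F_def by (intro defT1I dintros defP2D[OF Q])
  moreover have "Q x (F x)" if x: "x \<in> A" for x
  proof -
    have ex1: "\<exists>!z. z \<in> (\<lambda>y. vpair x y) ` {y \<in> elts b. Q x y} \<inter> elts c"
      using c[OF x] unfolding E .
    then have "\<exists>z. z \<in> (\<lambda>y. vpair x y) ` {y \<in> elts b. Q x y} \<inter> elts c"
      by (rule ex1_implies_ex)
    then obtain y where y: "y \<in> elts b" "Q x y" "vpair x y \<in> elts c"
      by auto
    have uniq: "y' = y" if y': "y' \<in> elts b" "Q x y'" "vpair x y' \<in> elts c" for y'
    proof -
      have "vpair x y' = vpair x y"
        by (rule Uniq_D[OF conjunct2[OF ex1[unfolded ex1_iff_ex_Uniq]]]) (simp_all add: image_iff y y')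
      then show ?thesis by simp
    qed
    have "{u. \<exists>y\<in>elts b. Q x y \<and> vpair x y \<in> elts c \<and> u \<in> elts y} = elts y"
    proof (intro set_eqI iffI)
      fix u assume "u \<in> {u. \<exists>y\<in>elts b. Q x y \<and> vpair x y \<in> elts c \<and> u \<in> elts y}"
      then obtain y' where "y' \<in> elts b" "Q x y'" "vpair x y' \<in> elts c" "u \<in> elts y'" by blast
      with uniq[of y'] show "u \<in> elts y" by simp
    qed (use y in blast)
    with y(2) show "Q x (F x)" by (simp add: F_def)
  qed
  ultimately show ?thesis by blast
qed

end

section \<open>Sets of size less than \<open>\<kappa>\<close>\<close>

context regular
begin

abbreviation few :: "'v \<Rightarrow> bool" where
  "few c \<equiv> card_less c \<kappa>"

text \<open>Zermelo's argument along \<kappa>: keep choosing an element of \<open>c\<close> not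
  chosen so far. Either this exhausts \<open>c\<close> at some stage below \<kappa>, or it injects
  \<kappa> into \<open>c\<close>.\<close>

lemma le_or_covered:
  assumes "\<not> card_le \<kappa> c"
  shows "\<exists>\<alpha>\<in>elts \<kappa>. \<exists>F. defT1 F \<and> elts c \<subseteq> F ` elts \<alpha>"
proof -
  let ?A = "{x \<in> {x. elts x \<subseteq> elts c}. elts x \<noteq> {}}"
  have "\<exists>f. defT1 f \<and> (\<forall>x\<in>?A. f x \<in> elts x)"
  proof (rule class_choice)
    show "small ?A" by (intro small_Collect small_Pow small_elts dintros)
    show "defP2 (\<lambda>x y. y \<in> elts x)" unfolding defP2_def by (intro dintros)
  qed auto
  then obtain f where f: "defT1 f" "\<forall>x\<in>?A. f x \<in> elts x" by blast
  define G where "G h = f (vset (elts c - {v. \<exists>z. vpair z v \<in> elts h}))" for h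
  have G: "defT1 G" unfolding G_def by (intro defT1I dintros defT1D[OF f(1)])
  define F where "F = eps_rec G"
  have F: "defT1 F" unfolding F_def by (rule defT1_eps_rec[OF G])
  have F_eq: "F \<alpha> = f (vset (elts c - F ` elts \<alpha>))" for \<alpha>
  proof -
    have "F \<alpha> = G (graph F \<alpha>)" unfolding F_def by (rule eps_rec[OF G])
    also have "{v. \<exists>z. vpair z v \<in> elts (graph F \<alpha>)} = F ` elts \<alpha>"
      unfolding elts_graph[OF F] by (auto simp: image_iff)
    then have "G (graph F \<alpha>) = f (vset (elts c - F ` elts \<alpha>))" by (simp add: G_def)
    finally show ?thesis .
  qed
  have F_in: "F \<alpha> \<in> elts c - F ` elts \<alpha>" if "\<not> elts c \<subseteq> F ` elts \<alpha>" for \<alpha>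
  proof -
    have "small (elts c - F ` elts \<alpha>)" by (intro small_Diff small_elts small_defT1 F)
    then have e: "elts (vset (elts c - F ` elts \<alpha>)) = elts c - F ` elts \<alpha>" by (rule elts_vset)
    then have "vset (elts c - F ` elts \<alpha>) \<in> ?A" using that by auto
    with f(2) e show ?thesis unfolding F_eq[of \<alpha>] by blast
  qed
  show ?thesis
  proof (rule ccontr)
    assume "\<not> ?thesis"
    then have "\<not> elts c \<subseteq> F ` elts \<alpha>" if "\<alpha> \<in> elts \<kappa>" for \<alpha>
      using F that by blast
    then have F': "F \<alpha> \<in> elts c - F ` elts \<alpha>" if "\<alpha> \<in> elts \<kappa>" for \<alpha>
      using that F_in by blast
    have "inj_on F (elts \<kappa>)"
    proof (rule inj_onI)
      fix \<alpha> \<beta> assume "\<alpha> \<in> elts \<kappa>" "\<beta> \<in> elts \<kappa>" "F \<alpha> = F \<beta>"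
      with F'[of \<alpha>] F'[of \<beta>] kappa_linear[of \<alpha> \<beta>] show "\<alpha> = \<beta>"
        by (metis DiffE imageI)
    qed
    then have "card_le \<kappa> c" using F' F by (intro card_leI) auto
    with assms show False by contradiction
  qed
qed

text \<open>Sending \<beta> to the index at which \<open>H\<close> takes the value
  \<open>F \<beta>\<close> would map \<alpha> onto \<kappa> up to default values, against
  regularity.\<close>

lemma covered_not_le:
  assumes "\<alpha> \<in> elts \<kappa>" "defT1 F" "elts c \<subseteq> F ` elts \<alpha>" shows "\<not> card_le \<kappa> c"
proof
  assume "card_le \<kappa> c"
  then obtain H where H: "defT1 H" "inj_on H (elts \<kappa>)" "H ` elts \<kappa> \<subseteq> elts c" by (rule card_leE)
  \<comment> \<open>When \<open>F \<beta>\<close> is not a value of \<open>H\<close>, the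
    implication is vacuous and the default 0 in \<kappa> will do.\<close>
  let ?Q = "\<lambda>\<beta> \<gamma>. \<gamma> \<in> elts \<kappa> \<and> ((\<exists>\<delta>\<in>elts \<kappa>. H \<delta> = F \<beta>) \<longrightarrow> H \<gamma> = F \<beta>)"
  have "\<exists>k. defT1 k \<and> (\<forall>\<beta>\<in>elts \<alpha>. ?Q \<beta> (k \<beta>))"
  proof (rule class_choice)
    show "defP2 ?Q"
      unfolding defP2_def by (intro dintros defT1D[OF H(1)] defT1D[OF assms(2)])
    show "\<exists>\<gamma>. ?Q \<beta> \<gamma>" for \<beta> using empty_in by blast
  qed simp
  then obtain k where k: "defT1 k" "\<forall>\<beta>\<in>elts \<alpha>. ?Q \<beta> (k \<beta>)" by blast
  then obtain b where b: "b \<in> elts \<kappa>" "\<forall>\<beta>\<in>elts \<alpha>. k \<beta> \<in> elts b"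
    using kappa_regular[OF assms(1) k(1)] by blast
  then obtain \<beta> where \<beta>: "\<beta> \<in> elts \<alpha>" "H b = F \<beta>" using H(3) assms(3) by blast
  then have "k \<beta> \<in> elts \<kappa>" "H (k \<beta>) = H b" using k(2) b(1) by auto
  then have "k \<beta> = b" using H(2) b(1) by (auto dest: inj_onD)
  then show False using b \<beta> kappa_irrefl by blast
qed

text \<open>Comparability with \<kappa>: a set into which \<kappa> does not embed is covered by some
  \<alpha> in \<kappa>, and choosing preimages in \<alpha> embeds it into \<kappa>.\<close>

lemma few_iff_not_le: "few c \<longleftrightarrow> \<not> card_le \<kappa> c"
proof
  assume "\<not> card_le \<kappa> c"
  then obtain \<alpha> F where F: "\<alpha> \<in> elts \<kappa>" "defT1 F" "elts c \<subseteq> F ` elts \<alpha>"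
    using le_or_covered by blast
  let ?Q = "\<lambda>x y. y \<in> elts \<alpha> \<and> F y = x"
  have "\<exists>k. defT1 k \<and> (\<forall>x\<in>elts c. ?Q x (k x))"
  proof (rule class_choice)
    show "defP2 ?Q" unfolding defP2_def by (intro dintros defT1D[OF F(2)])
    show "\<exists>y. ?Q x y" if "x \<in> elts c" for x using F(3) that by blast
  qed simp
  then obtain k where k: "defT1 k" "\<forall>x\<in>elts c. ?Q x (k x)" by blast
  have "inj_on k (elts c)" using k(2) by (metis inj_onI)
  moreover have "k ` elts c \<subseteq> elts \<kappa>" using k(2) kappa_down[OF F(1)] by blast
  ultimately have "card_le c \<kappa>" by (rule card_leI[OF k(1)])
  with \<open>\<not> card_le \<kappa> c\<close> show "few c" by (simp add: card_less_def)
qed (simp add: card_less_def)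

lemma few_card_le: "few c \<Longrightarrow> card_le c \<kappa>"
  by (simp add: card_less_def)

lemma few_iff_covered: "few c \<longleftrightarrow> (\<exists>\<alpha>\<in>elts \<kappa>. \<exists>F. defT1 F \<and> elts c \<subseteq> F ` elts \<alpha>)"
  using le_or_covered covered_not_le few_iff_not_le by blast

lemma few_mono: "few b \<Longrightarrow> card_le a b \<Longrightarrow> few a"
  unfolding few_iff_not_le using card_le_trans by blast

lemma few_subset: "few b \<Longrightarrow> elts a \<subseteq> elts b \<Longrightarrow> few a"
  using few_mono card_le_subset by blast

lemma few_image:
  assumes "few c" "defT1 F" shows "few (vset (F ` elts c))"
proof -
  obtain \<alpha> H where H: "\<alpha> \<in> elts \<kappa>" "defT1 H" "elts c \<subseteq> H ` elts \<alpha>"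
    using assms(1) few_iff_covered by blast
  have "elts (vset (F ` elts c)) \<subseteq> (\<lambda>x. F (H x)) ` elts \<alpha>"
    using H(3) assms(2) by auto
  then show ?thesis using few_iff_covered H(1) defT1_comp[OF assms(2) H(2)] by blast
qed

lemma few_bounded:
  assumes "few c" "defT1 F" "F ` elts c \<subseteq> elts \<kappa>"
  shows "\<exists>b\<in>elts \<kappa>. \<forall>x\<in>elts c. F x \<in> elts b"
proof -
  obtain \<alpha> H where H: "\<alpha> \<in> elts \<kappa>" "defT1 H" "elts c \<subseteq> H ` elts \<alpha>"
    using assms(1) few_iff_covered by blast
  \<comment> \<open>Indices that \<open>H\<close> sends outside \<open>c\<close> receive the
    harmless value 0, so that regularity applies to all of \<alpha>.\<close>
  let ?k = "\<lambda>\<beta>. if H \<beta> \<in> elts c then F (H \<beta>) else vset {}"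
  have "defT1 ?k" by (intro defT1I dintros defT1D[OF H(2)] defT1D[OF assms(2)])
  moreover have "?k ` elts \<alpha> \<subseteq> elts \<kappa>" using assms(3) empty_in by auto
  ultimately obtain b where b: "b \<in> elts \<kappa>" "\<forall>\<beta>\<in>elts \<alpha>. ?k \<beta> \<in> elts b"
    using kappa_regular[OF H(1)] by blast
  have "F x \<in> elts b" if x: "x \<in> elts c" for x
  proof -
    obtain \<beta> where "\<beta> \<in> elts \<alpha>" "x = H \<beta>" using x H(3) by blast
    with b(2) x show ?thesis by auto
  qed
  with b(1) show ?thesis by blast
qed

text \<open>Given an injection \<open>g\<close> of \<kappa> into the union, the indices landing in
  one \<open>s\<close> are few, hence below some \<open>k s\<close>, and the \<open>k s\<close> are
  below some \<open>b\<close>. But \<open>g b\<close> lies in some \<open>s\<close>, whence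
  \<open>b \<in> k s \<in> b\<close>.\<close>

lemma few_Union:
  assumes "few S" "\<And>s. s \<in> elts S \<Longrightarrow> few s" shows "few (vset (\<Union> (elts ` elts S)))"
  unfolding few_iff_not_le
proof
  have U: "elts (vset (\<Union> (elts ` elts S))) = \<Union> (elts ` elts S)"
    by (intro elts_vset small_UN_elts small_elts)
  assume "card_le \<kappa> (vset (\<Union> (elts ` elts S)))"
  then obtain g where g: "defT1 g" "inj_on g (elts \<kappa>)"
    and "g ` elts \<kappa> \<subseteq> elts (vset (\<Union> (elts ` elts S)))"
    by (rule card_leE)
  then have g3: "g ` elts \<kappa> \<subseteq> \<Union> (elts ` elts S)" by (simp only: U)
  let ?Q = "\<lambda>s b. b \<in> elts \<kappa> \<and> (\<forall>\<alpha>\<in>elts \<kappa>. g \<alpha> \<in> elts s \<longrightarrow> \<alpha> \<in> elts b)"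
  have "\<exists>k. defT1 k \<and> (\<forall>s\<in>elts S. ?Q s (k s))"
  proof (rule class_choice)
    show "defP2 ?Q" unfolding defP2_def by (intro dintros defT1D[OF g(1)])
    fix s assume s: "s \<in> elts S"
    let ?T = "vset {\<alpha> \<in> elts \<kappa>. g \<alpha> \<in> elts s}"
    have T: "elts ?T = {\<alpha> \<in> elts \<kappa>. g \<alpha> \<in> elts s}"
      by (intro elts_vset small_Collect small_elts dintros defT1D[OF g(1)])
    have "card_le ?T s"
      by (rule card_leI[OF g(1)]) (use g(2) T in \<open>auto intro: inj_on_subset\<close>)
    then have "few ?T" using assms(2) s few_mono by blast
    moreover have "(\<lambda>x. x) ` elts ?T \<subseteq> elts \<kappa>" unfolding T by blast
    ultimately obtain b where "b \<in> elts \<kappa>" "\<forall>x\<in>elts ?T. x \<in> elts b"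
      using few_bounded[of ?T "\<lambda>x. x"] defT1_id by blast
    then show "\<exists>b. ?Q s b" unfolding T by blast
  qed simp
  then obtain k where k: "defT1 k" "\<forall>s\<in>elts S. ?Q s (k s)" by blast
  then obtain b where b: "b \<in> elts \<kappa>" "\<forall>s\<in>elts S. k s \<in> elts b"
    using few_bounded[OF assms(1) k(1)] by blast
  obtain s where s: "s \<in> elts S" "g b \<in> elts s" using g3 b(1) by blast
  then have "b \<in> elts (k s)" "k s \<in> elts b" using k(2) b by auto
  then show False using kappa_trans[OF b(1)] kappa_irrefl[OF b(1)] by blast
qed

lemma few_doubleton: "few (vset {a, b})"
proof -
  obtain \<beta> where \<beta>: "\<beta> \<in> elts \<kappa>" "vset {} \<in> elts \<beta>" using kappa_limit[OF empty_in] by blast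
  obtain \<gamma> where \<gamma>: "\<gamma> \<in> elts \<kappa>" "\<beta> \<in> elts \<gamma>" using kappa_limit[OF \<beta>(1)] by blast
  \<comment> \<open>\<open>\<gamma>\<close> has at least the two elements 0 and
    \<open>\<beta>\<close>, which are sent to \<open>a\<close> and \<open>b\<close>.\<close>
  let ?F = "\<lambda>x. if x = vset {} then a else b"
  have "b = ?F \<beta>" using \<beta>(2) by auto
  then have "b \<in> ?F ` elts \<gamma>" using \<gamma>(2) by (rule image_eqI)
  moreover have "a \<in> ?F ` elts \<gamma>"
    using kappa_trans[OF \<gamma>(1) \<beta>(2) \<gamma>(2)] by (intro image_eqI[of _ _ "vset {}"]) simp_all
  ultimately have "elts (vset {a, b}) \<subseteq> ?F ` elts \<gamma>" by simp
  moreover have "defT1 ?F" by (intro defT1I dintros)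
  ultimately show ?thesis using \<gamma>(1) few_iff_covered by blast
qed

lemma few_singleton: "few (vset {a})"
  using few_doubleton[of a a] by simp

lemma few_empty: "few (vset {})"
  by (rule few_subset[OF few_singleton]) simp

lemma few_Un:
  assumes "few a" "few b" shows "few (vset (elts a \<union> elts b))"
proof -
  have "few (vset (\<Union> (elts ` elts (vset {a, b}))))"
    by (rule few_Union[OF few_doubleton]) (use assms in auto)
  then show ?thesis by simp
qed

end

section \<open>Ideals and objects\<close>

definition vun :: "'v::zfc_model \<Rightarrow> 'v \<Rightarrow> 'v" where
  "vun a b = vset (elts a \<union> elts b)"

definition vint :: "'v::zfc_model \<Rightarrow> 'v \<Rightarrow> 'v" where
  "vint a b = vset (elts a \<inter> elts b)"

definition vUnion :: "'v::zfc_model \<Rightarrow> 'v" where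
  "vUnion S = vset (\<Union> (elts ` elts S))"

definition preimage :: "('v::zfc_model \<Rightarrow> 'v) \<Rightarrow> 'v \<Rightarrow> 'v \<Rightarrow> 'v" where
  "preimage g a c = vset {x \<in> elts a. g x \<in> elts c}"

lemma elts_vun [simp]: "elts (vun a b) = elts a \<union> elts b"
  unfolding vun_def by (intro elts_vset small_Un small_elts)

lemma elts_vint [simp]: "elts (vint a b) = elts a \<inter> elts b"
  unfolding vint_def by (intro elts_vset small_Int small_elts)

lemma elts_vUnion [simp]: "elts (vUnion S) = \<Union> (elts ` elts S)"
  unfolding vUnion_def by (intro elts_vset small_UN_elts small_elts)

lemma elts_preimage: "defT1 g \<Longrightarrow> elts (preimage g a c) = {x \<in> elts a. g x \<in> elts c}"
  unfolding preimage_def by (intro elts_vset small_Collect small_elts dintros defT1D[of g])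

lemma defT1_preimage:
  assumes "defT1 g" shows "defT1 (preimage g a)"
  unfolding preimage_def by (intro defT1I dintros defT1D[OF assms])

lemma card_le_refl: "card_le a a"
  by (rule card_le_subset) simp

lemma card_le_vsum_right: "card_le k (vsum x k)" for k :: "'v::zfc_model"
proof (rule card_leI)
  have "small (vpair (vset {}) ` elts x \<union> vpair (vset {vset {}}) ` elts k)"
    by (intro small_Un small_image small_elts dintros)
  then show "vpair (vset {vset {}}) ` elts k \<subseteq> elts (vsum x k)"
    unfolding vsum_def by (simp only: elts_vset) blast
qed (auto intro!: inj_onI defT1I dintros)

lemma elts_vsum: "elts (vsum a b) = vpair (vset {}) ` elts a \<union> vpair (vset {vset {}}) ` elts b"
  unfolding vsum_def by (intro elts_vset small_Un small_image small_elts dintros)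

lemma card_le_vsum_mono:
  assumes "elts x \<subseteq> elts y" shows "card_le (vsum x k) (vsum y k)"
  by (rule card_le_subset) (use assms in \<open>auto simp: elts_vsum\<close>)

context regular
begin

lemma few_vUnion: "few S \<Longrightarrow> (\<And>s. s \<in> elts S \<Longrightarrow> few s) \<Longrightarrow> few (vUnion S)"
  unfolding vUnion_def by (rule few_Union)

lemma few_vun: "few a \<Longrightarrow> few b \<Longrightarrow> few (vun a b)"
  unfolding vun_def by (rule few_Un)

lemma small_unions_iff: "u \<in> small_unions \<kappa> X \<longleftrightarrow> (\<exists>S. elts S \<subseteq> X \<and> few S \<and> u = vUnion S)"
proof -
  have "elts u = \<Union> (elts ` elts S) \<longleftrightarrow> u = vUnion S" for S
    using elts_inject[of u "vUnion S"] by simp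
  then show ?thesis by (simp add: small_unions_def)
qed

lemma is_class_small_unions:
  assumes "is_class X" shows "is_class (small_unions \<kappa> X)"
  unfolding small_unions_def by (intro is_classI dintros is_classD[OF assms])

section \<open>Ideals closed under unions of fewer than \<kappa> members\<close>

definition ideal :: "'v set \<Rightarrow> bool" where
  "ideal J \<longleftrightarrow> is_class J \<and> (\<forall>a\<in>J. \<forall>b. elts b \<subseteq> elts a \<longrightarrow> b \<in> J) \<and>
     (\<forall>S. elts S \<subseteq> J \<and> few S \<longrightarrow> vUnion S \<in> J)"

lemma ideal_class: "ideal J \<Longrightarrow> is_class J"
  by (simp add: ideal_def)

lemma ideal_subset: "ideal J \<Longrightarrow> a \<in> J \<Longrightarrow> elts b \<subseteq> elts a \<Longrightarrow> b \<in> J"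
  by (simp add: ideal_def)

lemma ideal_vUnion: "ideal J \<Longrightarrow> elts S \<subseteq> J \<Longrightarrow> few S \<Longrightarrow> vUnion S \<in> J"
  by (simp add: ideal_def)

lemma ideal_vun:
  assumes "ideal J" "a \<in> J" "b \<in> J" shows "vun a b \<in> J"
proof -
  have "vUnion (vset {a, b}) \<in> J"
    by (rule ideal_vUnion[OF assms(1) _ few_doubleton]) (use assms in simp)
  then show ?thesis by (simp add: vUnion_def vun_def)
qed

lemma ideal_subset_vun:
  "ideal J \<Longrightarrow> a \<in> J \<Longrightarrow> b \<in> J \<Longrightarrow> elts c \<subseteq> elts a \<union> elts b \<Longrightarrow> c \<in> J"
  using ideal_subset[OF _ ideal_vun, of J a b c] by simp

lemma ideal_empty:
  assumes "ideal J" shows "vset {} \<in> J"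
proof -
  have "vUnion (vset {}) \<in> J" by (rule ideal_vUnion[OF assms _ few_empty]) simp
  then show ?thesis by (simp add: vUnion_def)
qed

definition cov :: "'v set \<Rightarrow> 'v set" where
  "cov X = {a. \<exists>x\<in>small_unions \<kappa> X. elts a \<subseteq> elts x}"

lemma cov_iff: "a \<in> cov X \<longleftrightarrow> (\<exists>S. elts S \<subseteq> X \<and> few S \<and> elts a \<subseteq> elts (vUnion S))"
  unfolding cov_def mem_Collect_eq Bex_def small_unions_iff by metis

text \<open>Choose for each of few members a small cover from \<open>X\<close>; by regularity the
  union of these few covers is again small.\<close>

lemma ideal_cov:
  assumes X: "is_class X" shows "ideal (cov X)"
  unfolding ideal_def
proof (intro conjI allI ballI impI)
  show "is_class (cov X)"
    unfolding cov_def by (intro is_classI dintros is_classD[OF is_class_small_unions[OF X]])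
  show "b \<in> cov X" if "a \<in> cov X" "elts b \<subseteq> elts a" for a b
    using that unfolding cov_def by blast
  fix S assume S: "elts S \<subseteq> cov X \<and> few S"
  let ?Q = "\<lambda>s T. elts T \<subseteq> X \<and> few T \<and> elts s \<subseteq> \<Union> (elts ` elts T)"
  have "\<exists>F. defT1 F \<and> (\<forall>s\<in>elts S. ?Q s (F s))"
  proof (rule class_choice)
    show "defP2 ?Q" unfolding defP2_def by (intro dintros is_classD[OF X])
    show "\<exists>T. ?Q s T" if "s \<in> elts S" for s
      using S that cov_iff[of s X] by auto
  qed simp
  then obtain F where F: "defT1 F" "\<forall>s\<in>elts S. ?Q s (F s)" by blast
  let ?T = "vUnion (vset (F ` elts S))"
  have T: "elts ?T = (\<Union>s\<in>elts S. elts (F s))" using F(1) by simp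
  have "few ?T"
  proof (rule few_vUnion)
    show "few (vset (F ` elts S))" using S F(1) by (intro few_image) auto
    show "few t" if "t \<in> elts (vset (F ` elts S))" for t using that F by auto
  qed
  moreover have "elts ?T \<subseteq> X" unfolding T using F(2) by blast
  moreover have "elts (vUnion S) \<subseteq> elts (vUnion ?T)"
  proof
    fix x assume "x \<in> elts (vUnion S)"
    then obtain s where s: "s \<in> elts S" "x \<in> elts s" by auto
    then obtain t where "t \<in> elts (F s)" "x \<in> elts t" using F(2) by blast
    with s(1) show "x \<in> elts (vUnion ?T)" unfolding elts_vUnion[of ?T] T by blast
  qed
  ultimately show "vUnion S \<in> cov X" unfolding cov_iff by blast
qed

lemma cov_least:
  assumes "ideal J" "X \<subseteq> J" shows "cov X \<subseteq> J"
proof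
  fix a assume "a \<in> cov X"
  then obtain S where S: "elts S \<subseteq> X" "few S" "elts a \<subseteq> elts (vUnion S)"
    unfolding cov_iff by blast
  then have "vUnion S \<in> J" using assms by (intro ideal_vUnion) auto
  then show "a \<in> J" using S(3) by (rule ideal_subset[OF assms(1)])
qed

lemma subset_small_unions: "X \<subseteq> small_unions \<kappa> X"
proof
  fix x assume "x \<in> X"
  moreover have "x = vUnion (vset {x})" by (simp add: vUnion_def)
  ultimately show "x \<in> small_unions \<kappa> X"
    unfolding small_unions_iff using few_singleton by (intro exI[of _ "vset {x}"]) simp
qed

lemma small_unions_cov: "small_unions \<kappa> X \<subseteq> cov X"
  unfolding cov_def by blast

lemma subset_cov: "X \<subseteq> cov X"
  by (rule subset_trans[OF subset_small_unions small_unions_cov])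

lemma cov_ideal: "ideal J \<Longrightarrow> cov J = J"
  by (rule equalityI[OF cov_least subset_cov]) simp_all

lemma small_unions_ideal: "ideal J \<Longrightarrow> small_unions \<kappa> J = J"
  using subset_small_unions[of J] small_unions_cov[of J] cov_ideal[of J] by blast

lemma class_arr_small_unions: "class_arr (small_unions \<kappa> X) Y \<longleftrightarrow> cov X \<subseteq> {a. \<exists>y\<in>Y. elts a \<subseteq> elts y}"
  unfolding class_arr_def vsubset_def cov_def by blast

lemma St_obj_small_unions:
  assumes "is_class X" shows "St_obj \<kappa> (small_unions \<kappa> X)"
proof -
  have "cov (small_unions \<kappa> X) \<subseteq> cov X"
    by (rule cov_least[OF ideal_cov[OF assms] small_unions_cov])
  then show ?thesis
    unfolding St_obj_def class_arr_small_unions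
    using is_class_small_unions[OF assms] by (simp add: cov_def)
qed

lemma St_obj_cov: "St_obj \<kappa> W \<Longrightarrow> a \<in> cov W \<longleftrightarrow> (\<exists>w\<in>W. elts a \<subseteq> elts w)"
  unfolding St_obj_def class_arr_small_unions using subset_small_unions[of W]
  by (auto simp: cov_def)

text \<open>A device for induction over a generated ideal: since the condition on \<open>c\<close>
  defines an ideal, it need only be checked on generators.\<close>

lemma ideal_preimage:
  assumes "ideal J" "defT1 g" shows "ideal {c. preimage g a c \<in> J}"
  unfolding ideal_def
proof (intro conjI allI ballI impI)
  show "is_class {c. preimage g a c \<in> J}"
    by (intro is_classI dintros is_classD[OF ideal_class[OF assms(1)]]
        defT1D[OF defT1_preimage[OF assms(2)]])
  show "b \<in> {c. preimage g a c \<in> J}"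
    if "c \<in> {c. preimage g a c \<in> J}" "elts b \<subseteq> elts c" for b c
  proof -
    have "elts (preimage g a b) \<subseteq> elts (preimage g a c)"
      using that(2) unfolding elts_preimage[OF assms(2)] by blast
    with that(1) show ?thesis using ideal_subset[OF assms(1)] by blast
  qed
  fix S assume S: "elts S \<subseteq> {c. preimage g a c \<in> J} \<and> few S"
  let ?T = "vset (preimage g a ` elts S)"
  have T: "elts ?T = preimage g a ` elts S" by (rule elts_vset_image[OF defT1_preimage[OF assms(2)]])
  have "vUnion ?T \<in> J"
  proof (rule ideal_vUnion[OF assms(1)])
    show "few ?T" using S by (intro few_image[OF _ defT1_preimage[OF assms(2)]]) simp
    show "elts ?T \<subseteq> J" unfolding T using S by blast
  qed
  then have "preimage g a (vUnion S) \<in> J"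
    by (rule ideal_subset[OF assms(1)]) (auto simp only: elts_vUnion T elts_preimage[OF assms(2)] UN_iff image_iff)
  then show "vUnion S \<in> {c. preimage g a c \<in> J}" by simp
qed

text \<open>
  Using unions of fewer than \<open>\<kappa>\<close> sets of size at most \<open>\<kappa>\<close> instead of the latter sets
  avoids the computation of \<open>\<kappa> \<cdot> \<kappa>\<close>.
\<close>

definition kbdd :: "'v set" where
  "kbdd = cov {a. card_le a \<kappa>}"

lemma ideal_kbdd: "ideal kbdd"
  unfolding kbdd_def by (intro ideal_cov is_classI dintros)

lemma kbdd_le: "card_le a \<kappa> \<Longrightarrow> a \<in> kbdd"
  unfolding kbdd_def by (rule subsetD[OF subset_cov]) simp

text \<open>The \<open>preimage\<close> along the identity is intersection with \<open>b\<close>.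
  The sets whose intersection with \<open>b\<close> is in \<open>J\<close> form an ideal containing
  all sets of size at most \<kappa>, hence all of \<open>kbdd\<close>, and in particular
  \<open>b\<close>.\<close>

lemma kbdd_induct:
  assumes "b \<in> kbdd" "ideal J" "\<And>a. elts a \<subseteq> elts b \<Longrightarrow> card_le a \<kappa> \<Longrightarrow> a \<in> J"
  shows "b \<in> J"
proof -
  let ?J = "{c. preimage (\<lambda>x. x) b c \<in> J}"
  have "kbdd \<subseteq> ?J"
    unfolding kbdd_def
  proof (rule cov_least[OF ideal_preimage[OF assms(2) defT1_id]], intro subsetI CollectI, rule assms(3))
    fix c assume c: "c \<in> {a. card_le a \<kappa>}"
    show "elts (preimage (\<lambda>x. x) b c) \<subseteq> elts b" by (auto simp: elts_preimage)
    have "card_le (preimage (\<lambda>x. x) b c) c" by (rule card_le_subset) (auto simp: elts_preimage)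
    with c show "card_le (preimage (\<lambda>x. x) b c) \<kappa>" using card_le_trans by blast
  qed
  with assms(1) have "preimage (\<lambda>x. x) b b \<in> J" by blast
  then show ?thesis by (rule ideal_subset[OF assms(2)]) (simp add: elts_preimage)
qed

text \<open>Preimages under an injection do not grow in size, so pulling back along \<open>g\<close>
  preserves the generators of \<open>kbdd\<close> and thereby the whole ideal.\<close>

lemma kbdd_card_le:
  assumes "b \<in> kbdd" "card_le a b" shows "a \<in> kbdd"
proof -
  obtain g where g: "defT1 g" "inj_on g (elts a)" "g ` elts a \<subseteq> elts b"
    using assms(2) by (rule card_leE)
  have "b \<in> {c. preimage g a c \<in> kbdd}"
  proof (rule kbdd_induct[OF assms(1) ideal_preimage[OF ideal_kbdd g(1)]], intro CollectI kbdd_le)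
    fix c assume "card_le c \<kappa>"
    have "card_le (preimage g a c) c"
      by (rule card_leI[OF g(1)]) (auto simp: elts_preimage g(1) intro: inj_on_subset[OF g(2)])
    with \<open>card_le c \<kappa>\<close> show "card_le (preimage g a c) \<kappa>" using card_le_trans by blast
  qed
  then have "preimage g a b \<in> kbdd" by simp
  then show ?thesis
    by (rule ideal_subset[OF ideal_kbdd]) (use g in \<open>auto simp: elts_preimage\<close>)
qed

lemma card_le_image:
  assumes "defT1 F" shows "card_le (vset (F ` elts a)) (a :: 'v)"
proof -
  let ?Q = "\<lambda>y x. x \<in> elts a \<and> F x = y"
  have "\<exists>k. defT1 k \<and> (\<forall>y\<in>F ` elts a. ?Q y (k y))"
  proof (rule class_choice[where Q = ?Q])
    show "small (F ` elts a)" by (intro small_defT1 small_elts assms)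
    show "defP2 ?Q" unfolding defP2_def by (intro dintros defT1D[OF assms])
  qed blast
  then obtain k where k: "defT1 k" "\<forall>y\<in>F ` elts a. ?Q y (k y)" by blast
  have "inj_on k (F ` elts a)" using k(2) by (metis inj_onI)
  moreover have "k ` F ` elts a \<subseteq> elts a" using k(2) by blast
  ultimately show ?thesis using card_leI[OF k(1)] elts_vset_image[OF assms] by simp
qed

lemma kbdd_vsum:
  assumes "u \<in> kbdd" shows "vsum u \<kappa> \<in> kbdd"
proof (rule ideal_subset_vun[OF ideal_kbdd])
  have d: "defT1 (vpair c)" for c :: 'v by (intro defT1I dintros)
  let ?a = "vset (vpair (vset {}) ` elts u)" and ?b = "vset (vpair (vset {vset {}}) ` elts \<kappa>)"
  show "?a \<in> kbdd" by (rule kbdd_card_le[OF assms card_le_image[OF d]])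
  show "?b \<in> kbdd" by (rule kbdd_le[OF card_le_image[OF d]])
  show "elts (vsum u \<kappa>) \<subseteq> elts ?a \<union> elts ?b" by (simp add: elts_vsum d)
qed

lemma few_kbdd: "few a \<Longrightarrow> a \<in> kbdd"
  by (intro kbdd_le few_card_le)

section \<open>Lifting along (wf) arrows, and cuteness\<close>

lemma St_obj_nonempty:
  assumes "St_obj \<kappa> W" obtains w where "w \<in> W"
proof -
  have "vset {} \<in> cov W"
    using assms by (intro ideal_empty ideal_cov) (simp add: St_obj_def)
  then show thesis using St_obj_cov[OF assms] that by blast
qed

text \<open>Sets of size at most \<kappa> meet the bound in (wf) for every \<open>w\<close>, so they
  lift individually; since \<open>W\<close> is directed, small unions of them lift as well.\<close>

lemma St_wf_kbdd:
  assumes "St_wf \<kappa> W Y" "y \<in> Y" "elts a \<subseteq> elts y" "a \<in> kbdd"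
  shows "\<exists>w\<in>W. elts a \<subseteq> elts w"
proof -
  have W: "St_obj \<kappa> W" using assms(1) by (simp add: St_wf_def St_arr_def)
  obtain w where w: "w \<in> W" using W by (rule St_obj_nonempty)
  have "ideal (cov W)" using W by (intro ideal_cov) (simp add: St_obj_def)
  with assms(4) have "a \<in> cov W"
  proof (rule kbdd_induct)
    fix b assume b: "elts b \<subseteq> elts a" "card_le b \<kappa>"
    then have "card_le b (vsum w \<kappa>)" using card_le_trans card_le_vsum_right by blast
    moreover have "vsubset b y" using b(1) assms(3) by (auto simp: vsubset_def)
    ultimately show "b \<in> cov W"
      unfolding St_obj_cov[OF W] using assms(1,2) w unfolding St_wf_def vsubset_def by blast
  qed
  then show ?thesis by (simp add: St_obj_cov[OF W])
qed

text \<open>Cuteness is automatic here. The set \<open>A\<close> lies in \<open>kbdd\<close>, so it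
  is below some \<open>w\<close> of \<open>W\<close>; then \<open>B\<close> has size at most that of
  \<open>w\<close> plus \<kappa>, and (wf) puts it below a member of \<open>W\<close>, hence of
  \<open>X\<close>.\<close>

lemma Qt_obj_kbdd:
  assumes X: "is_class X" "X \<subseteq> kbdd" shows "Qt_obj \<kappa> X"
  unfolding Qt_obj_def cute_def
proof (intro conjI allI impI)
  show "is_class X" by (rule X)
  show obj: "St_obj \<kappa> (small_unions \<kappa> X)" by (rule St_obj_small_unions[OF X(1)])
  fix A B W
  assume *: "vsubset A B \<and> St_c \<kappa> {A} {B} \<and> St_wf \<kappa> W {B} \<and>
    St_arr \<kappa> W (small_unions \<kappa> X) \<and> St_arr \<kappa> {A} (small_unions \<kappa> X)"
  have "A \<in> cov X"
    using * by (auto simp: St_arr_def class_arr_def cov_def vsubset_def)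
  then have "A \<in> kbdd" using cov_least[OF ideal_kbdd X(2)] by blast
  then obtain w where w: "w \<in> W" "elts A \<subseteq> elts w"
    using St_wf_kbdd[of W "{B}" B A] * by (auto simp: vsubset_def)
  have "card_le B (vsum A \<kappa>)" using * by (simp add: St_c_def)
  then have "card_le B (vsum w \<kappa>)" using card_le_trans card_le_vsum_mono[OF w(2)] by blast
  then obtain v where v: "v \<in> W" "elts B \<subseteq> elts v"
    using * w(1) unfolding St_wf_def vsubset_def by blast
  then obtain x where x: "x \<in> small_unions \<kappa> X" "elts v \<subseteq> elts x"
    using * unfolding St_arr_def class_arr_def vsubset_def by blast
  have "St_obj \<kappa> {B}" using * by (simp add: St_c_def St_arr_def)
  then show "St_arr \<kappa> {B} (small_unions \<kappa> X)"
    unfolding St_arr_def class_arr_def vsubset_def using obj v x by blast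
qed

lemma Qt_obj_class: "Qt_obj \<kappa> X \<Longrightarrow> is_class X"
  by (simp add: Qt_obj_def)

lemma Qt_arr_iff: "Qt_arr \<kappa> X Y \<longleftrightarrow> Qt_obj \<kappa> X \<and> Qt_obj \<kappa> Y \<and> cov X \<subseteq> cov Y"
proof -
  have "class_arr (small_unions \<kappa> X) (small_unions \<kappa> Y) \<longleftrightarrow> cov X \<subseteq> cov Y"
    unfolding class_arr_small_unions by (simp add: cov_def)
  then show ?thesis
    unfolding Qt_arr_def St_arr_def by (auto simp: Qt_obj_def intro: St_obj_small_unions)
qed

end

section \<open>Indecomposable arrows when \<open>\<kappa>\<close> is not measurable\<close>

context regular
begin

lemma small_Inter:
  assumes "s \<in> elts S" shows "small (\<Inter> (elts ` elts S))"
proof (rule small_subset[OF small_elts])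
  show "\<Inter> (elts ` elts S) \<subseteq> elts s" using assms by blast
  show "defP (\<lambda>e. e 0 \<in> \<Inter> (elts ` elts S))" by (intro dintros)
qed

text \<open>
  An injection of \<open>b\<close> into \<open>\<kappa>\<close> transports a prime ideal on \<open>b\<close> to a \<open>\<kappa>\<close>-complete
  ultrafilter on \<open>\<kappa>\<close>.
\<close>

lemma prime_ideal_principal:
  assumes "\<not> measurable \<kappa>" and J: "ideal J" and "card_le b \<kappa>" "b \<notin> J"
    and prime: "\<And>a. elts a \<subseteq> elts b \<Longrightarrow> a \<in> J \<or> vdiff b a \<in> J"
  shows "\<exists>q\<in>elts b. vset {q} \<notin> J"
proof -
  obtain g where g: "defT1 g" "inj_on g (elts b)" "g ` elts b \<subseteq> elts \<kappa>"
    using assms(3) by (rule card_leE)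
  define P where "P = preimage g b"
  have P: "elts (P a) = {x \<in> elts b. g x \<in> elts a}" for a
    unfolding P_def by (rule elts_preimage[OF g(1)])
  have defP1: "defT1 P" unfolding P_def by (rule defT1_preimage[OF g(1)])
  have cover: "\<not> elts b \<subseteq> elts c \<union> elts d" if "c \<in> J" "d \<in> J" for c d
    using ideal_subset_vun[OF J that, of b] assms(4) by blast
  define U where "U = vset {a \<in> {a. elts a \<subseteq> elts \<kappa>}. P a \<notin> J}"
  have "small {a \<in> {a. elts a \<subseteq> elts \<kappa>}. P a \<notin> J}"
    by (intro small_Collect small_Pow small_elts dintros is_classD[OF ideal_class[OF J]]
        defT1D[OF defP1])
  then have "elts U = {a \<in> {a. elts a \<subseteq> elts \<kappa>}. P a \<notin> J}"
    unfolding U_def by (rule elts_vset)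
  then have U: "a \<in> elts U \<longleftrightarrow> elts a \<subseteq> elts \<kappa> \<and> P a \<notin> J" for a by simp
  have compl: "vdiff b (P a) \<in> J" if "a \<in> elts U" for a
    using prime[of "P a"] that P[of a] U[of a] by auto
  have complete: "vset (\<Inter> (elts ` elts S)) \<in> elts U"
    if S: "elts S \<subseteq> elts U" "few S" "s \<in> elts S" for S s
  proof -
    let ?m = "vset (\<Inter> (elts ` elts S))" and ?F = "\<lambda>a. vdiff b (P a)"
    have m: "elts ?m = \<Inter> (elts ` elts S)" by (intro elts_vset small_Inter[OF S(3)])
    have F: "defT1 ?F" by (intro defT1I dintros defT1D[OF defP1])
    have "vUnion (vset (?F ` elts S)) \<in> J"
    proof (rule ideal_vUnion[OF J])
      show "elts (vset (?F ` elts S)) \<subseteq> J"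
        unfolding elts_vset_image[OF F] using compl S(1) by blast
      show "few (vset (?F ` elts S))" by (rule few_image[OF S(2) F])
    qed
    moreover have "elts b \<subseteq> elts (P ?m) \<union> elts (vUnion (vset (?F ` elts S)))"
      unfolding m elts_vUnion elts_vset_image[OF F] P by (auto simp: P)
    ultimately have "P ?m \<notin> J" using cover by blast
    moreover have "elts ?m \<subseteq> elts \<kappa>" unfolding m using S U[of s] by blast
    ultimately show ?thesis unfolding U by blast
  qed
  have "ultrafilter_on \<kappa> U"
    unfolding ultrafilter_on_def
  proof (intro conjI ballI allI impI)
    show "vsubset a \<kappa>" if "a \<in> elts U" for a using that U by (simp add: vsubset_def)
    have "P \<kappa> = b" using g(3) P[of \<kappa>] by (intro zfc_extensionality) blast
    then show "\<kappa> \<in> elts U" using assms(4) U by simp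
    have "P (vset {}) = vset {}" by (intro zfc_extensionality) (simp add: P)
    then show "vset {} \<notin> elts U" using ideal_empty[OF J] U by simp
    show "c \<in> elts U" if "a \<in> elts U" "vsubset a c \<and> vsubset c \<kappa>" for a c
    proof -
      have "elts (P a) \<subseteq> elts (P c)" using that(2) by (auto simp: P vsubset_def)
      then have "P c \<notin> J" using that(1) U ideal_subset[OF J] by blast
      then show ?thesis using that(2) U by (simp add: vsubset_def)
    qed
    show "vset (elts a \<inter> elts c) \<in> elts U" if "a \<in> elts U" "c \<in> elts U" for a c
      using complete[OF _ few_doubleton, of a c a] that by simp
    show "a \<in> elts U \<or> vdiff \<kappa> a \<in> elts U" if "vsubset a \<kappa>" for a
    proof (rule ccontr)
      assume "\<not> (a \<in> elts U \<or> vdiff \<kappa> a \<in> elts U)"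
      then have "P a \<in> J" "P (vdiff \<kappa> a) \<in> J" using that U by (auto simp: vsubset_def)
      moreover have "elts b \<subseteq> elts (P a) \<union> elts (P (vdiff \<kappa> a))" using g(3) by (auto simp: P)
      ultimately show False using cover by blast
    qed
  qed
  moreover have "complete_filter \<kappa> U"
    unfolding complete_filter_def vsubset_def using complete by blast
  moreover have "cardinal \<kappa>" using reg by (simp add: regular_cardinal_def)
  ultimately have "principal_on \<kappa> U"
    using assms(1) omega_in unfolding measurable_def by blast
  then obtain p where p: "p \<in> elts \<kappa>" "elts U = {a. vsubset a \<kappa> \<and> p \<in> elts a}"
    unfolding principal_on_def by blast
  \<comment> \<open>If \<open>p\<close> generates \<open>U\<close>, the preimage of its singleton is
    outside \<open>J\<close>, so it is nonempty and, \<open>g\<close> being injective, a singleton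
    itself.\<close>
  then have "vset {p} \<in> elts U" by (simp add: vsubset_def)
  then have "P (vset {p}) \<notin> J" using U by blast
  then obtain q where q: "q \<in> elts b" "g q = p"
    using ideal_subset[OF J ideal_empty[OF J], of "P (vset {p})"] by (auto simp: P)
  have "P (vset {p}) = vset {q}"
    using q g(2) by (intro zfc_extensionality) (auto simp: P inj_on_def)
  with \<open>P (vset {p}) \<notin> J\<close> q(1) show ?thesis by auto
qed

section \<open>From indecomposability to primeness\<close>

lemma cov_mono: "X \<subseteq> Y \<Longrightarrow> cov X \<subseteq> cov Y"
  unfolding cov_iff subset_iff by metis

text \<open>Dropping \<open>a\<close> from a small cover of \<open>c\<close> leaves a cover of the
  rest. With \<open>c = b\<close>, an arrow back to the object with \<open>a\<close> adjoined thus
  becomes a statement about \<open>b - a\<close>.\<close>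

lemma cov_insert:
  assumes "c \<in> cov (insert a X)" shows "vdiff c a \<in> cov X"
proof -
  obtain S where S: "elts S \<subseteq> insert a X" "few S" "elts c \<subseteq> \<Union> (elts ` elts S)"
    using assms unfolding cov_iff elts_vUnion by blast
  let ?T = "vdiff S (vset {a})"
  have "elts ?T \<subseteq> X" using S(1) by auto
  moreover have "few ?T" by (rule few_subset[OF S(2)]) simp
  moreover have "elts (vdiff c a) \<subseteq> elts (vUnion ?T)" using S(3) by auto
  ultimately show ?thesis unfolding cov_iff by blast
qed

lemma is_class_insert:
  assumes "is_class X" shows "is_class (insert (a :: 'v) X)"
  by (intro is_classI dintros is_classD[OF assms])

lemma St_wf_refl: "St_obj \<kappa> Y \<Longrightarrow> St_wf \<kappa> Y Y"
  unfolding St_wf_def St_arr_def class_arr_def vsubset_def by blast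

lemma Qt_wc_imp_w: "Qt_wc \<kappa> X Y \<Longrightarrow> Qt_w \<kappa> X Y"
  unfolding Qt_wc_def Qt_w_def St_w_def
  using St_wf_refl[of "small_unions \<kappa> Y"] by (auto simp: St_wc_def St_arr_def)

lemma Qt_wcI:
  assumes "Qt_arr \<kappa> X Y" "\<And>y. y \<in> cov Y \<Longrightarrow> \<exists>x\<in>cov X. few (vdiff y x)"
  shows "Qt_wc \<kappa> X Y"
  unfolding Qt_wc_def St_wc_def
proof (intro conjI ballI)
  show "Qt_arr \<kappa> X Y" "St_arr \<kappa> (small_unions \<kappa> X) (small_unions \<kappa> Y)"
    using assms(1) by (simp_all add: Qt_arr_def)
  fix y assume "y \<in> small_unions \<kappa> Y"
  then obtain x where x: "x \<in> cov X" "few (vdiff y x)"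
    using assms(2) small_unions_cov by blast
  then obtain x' where x': "x' \<in> small_unions \<kappa> X" "elts x \<subseteq> elts x'"
    unfolding cov_def by blast
  have "few (vdiff y x')" by (rule few_subset[OF x(2)]) (use x'(2) in auto)
  with x'(1) show "\<exists>x\<in>small_unions \<kappa> X. few (vdiff y x)" by blast
qed

lemma Qt_obj_le:
  assumes "is_class X" "\<And>x. x \<in> X \<Longrightarrow> card_le x \<kappa>" shows "Qt_obj \<kappa> X"
  using assms kbdd_le by (intro Qt_obj_kbdd) auto

text \<open>Small unions from the empty class are empty, so the bound in (c) is just a tagged copy
  of \<kappa>.\<close>

lemma Qt_c_empty_le:
  assumes "Qt_c \<kappa> {} Y" "y \<in> cov Y" shows "card_le y \<kappa>"
proof -
  have d: "defT1 (vpair c)" for c :: 'v by (intro defT1I dintros)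
  obtain y' where y': "y' \<in> small_unions \<kappa> Y" "elts y \<subseteq> elts y'"
    using assms(2) unfolding cov_def by blast
  then obtain x where x: "x \<in> small_unions \<kappa> {}" "card_le y' (vsum x \<kappa>)"
    using assms(1) unfolding Qt_c_def St_c_def by blast
  then have "elts x = {}" unfolding small_unions_iff by auto
  then have "vsum x \<kappa> = vset (vpair (vset {vset {}}) ` elts \<kappa>)" by (simp add: vsum_def)
  then have "card_le (vsum x \<kappa>) \<kappa>" using card_le_image[OF d] by simp
  then show ?thesis using x(2) card_le_subset[OF y'(2)] card_le_trans by blast
qed

text \<open>The label (c) bounds all sizes by \<kappa>: adjoining \<open>a\<close> then yields an
  object, and \<open>b\<close> embeds into \<kappa>. Once \<open>{q}\<close> is outside the ideal of
  \<open>X\<close>, primeness puts \<open>b - {q}\<close> into it and the dichotomy at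
  \<open>b\<close> puts \<open>y - b\<close> into it; so \<open>y\<close> exceeds the ideal by at
  most the point \<open>q\<close>.\<close>

lemma indecomposable_wc:
  assumes nm: "\<not> measurable \<kappa>" and ind: "indecomposable (Qt_arr \<kappa>) X Y" and c: "Qt_c \<kappa> {} Y"
  shows "Qt_wc \<kappa> X Y"
proof (rule Qt_wcI)
  show arr: "Qt_arr \<kappa> X Y" using ind by (simp add: indecomposable_def)
  then have XY: "Qt_obj \<kappa> X" "Qt_obj \<kappa> Y" "cov X \<subseteq> cov Y" by (simp_all add: Qt_arr_iff)
  have X: "is_class X" using XY(1) by (rule Qt_obj_class)
  have J: "ideal (cov X)" by (rule ideal_cov[OF X])
  have dichotomy: "a \<in> cov X \<or> cov Y \<subseteq> cov (insert a X)" if a: "a \<in> cov Y" for a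
  proof -
    have sub: "insert a X \<subseteq> cov Y" using a XY(3) subset_cov[of X] by blast
    then have Z: "Qt_obj \<kappa> (insert a X)"
      using Qt_c_empty_le[OF c] by (intro Qt_obj_le is_class_insert X) blast
    have "cov (insert a X) \<subseteq> cov Y" by (rule cov_least[OF ideal_cov[OF Qt_obj_class[OF XY(2)]] sub])
    moreover have "cov X \<subseteq> cov (insert a X)" by (rule cov_mono) blast
    ultimately have "Qt_arr \<kappa> X (insert a X)" "Qt_arr \<kappa> (insert a X) Y"
      using XY Z by (simp_all add: Qt_arr_iff)
    then have "Qt_arr \<kappa> (insert a X) X \<or> Qt_arr \<kappa> Y (insert a X)"
      using ind unfolding indecomposable_def thin_iso_def by blast
    then show ?thesis unfolding Qt_arr_iff using subset_cov[of "insert a X"] by blast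
  qed
  fix y assume y: "y \<in> cov Y"
  show "\<exists>x\<in>cov X. few (vdiff y x)"
  proof (cases "cov Y \<subseteq> cov X")
    case True
    with y have "y \<in> cov X" by blast
    moreover have "few (vdiff y y)" by (rule few_subset[OF few_empty]) simp
    ultimately show ?thesis by blast
  next
    case False
    then obtain b where b: "b \<in> cov Y" "b \<notin> cov X" by blast
    have prime: "a \<in> cov X \<or> vdiff b a \<in> cov X" if "elts a \<subseteq> elts b" for a
    proof -
      have "a \<in> cov Y"
        by (rule ideal_subset[OF ideal_cov[OF Qt_obj_class[OF XY(2)]] b(1) that])
      then show ?thesis using dichotomy b(1) cov_insert by blast
    qed
    obtain q where q: "q \<in> elts b" "vset {q} \<notin> cov X"
      using prime_ideal_principal[OF nm J Qt_c_empty_le[OF c b(1)] b(2) prime] by blast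
    then have "vdiff b (vset {q}) \<in> cov X" using prime[of "vset {q}"] by simp
    moreover have "vdiff y b \<in> cov X" using dichotomy[OF b(1)] b(2) y cov_insert by blast
    ultimately have "vun (vdiff y b) (vdiff b (vset {q})) \<in> cov X" by (intro ideal_vun[OF J])
    moreover have "few (vdiff y (vun (vdiff y b) (vdiff b (vset {q}))))"
      by (rule few_subset[OF few_singleton[of q]]) auto
    ultimately show ?thesis by blast
  qed
qed

lemma is_class_empty: "is_class ({} :: 'v set)"
  by (intro is_classI dintros)

lemma is_class_singleton: "is_class {a :: 'v}"
  by (intro is_class_insert is_class_empty)

lemma ideal_Pow: "ideal {a. elts a \<subseteq> elts b}"
  unfolding ideal_def by (auto intro!: is_classI dintros)

lemma cov_singleton: "cov {b} = {a. elts a \<subseteq> elts b}"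
proof
  show "cov {b} \<subseteq> {a. elts a \<subseteq> elts b}" by (rule cov_least[OF ideal_Pow]) simp
  show "{a. elts a \<subseteq> elts b} \<subseteq> cov {b}" using subset_cov[of "{b}"] by (auto simp: cov_def)
qed

lemma Qt_obj_empty: "Qt_obj \<kappa> {}"
  by (intro Qt_obj_le is_class_empty) simp

lemma Qt_obj_kappa: "Qt_obj \<kappa> {\<kappa>}"
  by (intro Qt_obj_le is_class_singleton) (simp add: card_le_refl)

lemma Qt_c_empty_kappa: "Qt_c \<kappa> {} {\<kappa>}"
proof -
  have arr: "Qt_arr \<kappa> {} {\<kappa>}"
    using Qt_obj_empty Qt_obj_kappa by (simp add: Qt_arr_iff cov_mono)
  obtain x where x: "x \<in> small_unions \<kappa> {}"
    using St_obj_nonempty[OF St_obj_small_unions[OF is_class_empty]] by blast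
  have "card_le y (vsum x \<kappa>)" if "y \<in> small_unions \<kappa> {\<kappa>}" for y
  proof -
    have "elts y \<subseteq> elts \<kappa>" using that small_unions_cov[of "{\<kappa>}"] cov_singleton by blast
    then show ?thesis using card_le_subset card_le_trans card_le_vsum_right by blast
  qed
  then show ?thesis using arr x unfolding Qt_c_def St_c_def Qt_arr_def by blast
qed

end

section \<open>Measurable cardinals and the homotopy category\<close>

context regular
begin

text \<open>The dual ideals of \<kappa>-complete non-principal ultrafilters on \<kappa>.\<close>

definition prime_kideal :: "'v set \<Rightarrow> bool" where
  "prime_kideal I \<longleftrightarrow> ideal I \<and> I \<subseteq> {a. elts a \<subseteq> elts \<kappa>} \<and> \<kappa> \<notin> I \<and>
     (\<forall>a. elts a \<subseteq> elts \<kappa> \<longrightarrow> a \<in> I \<or> vdiff \<kappa> a \<in> I) \<and>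
     (\<forall>a. elts a \<subseteq> elts \<kappa> \<and> few a \<longrightarrow> a \<in> I)"

text \<open>Non-principality enters through singletons: one in \<open>U\<close> would generate
  \<open>U\<close>. So all singletons are in the dual ideal, and with them their unions of length
  below \<kappa>.\<close>

lemma measurable_prime_kideal:
  assumes "measurable \<kappa>" shows "\<exists>I. prime_kideal I"
proof -
  obtain U where U: "ultrafilter_on \<kappa> U" "complete_filter \<kappa> U" "\<not> principal_on \<kappa> U"
    using assms unfolding measurable_def by blast
  have U_sub: "elts a \<subseteq> elts \<kappa>" if "a \<in> elts U" for a
    using U(1) that unfolding ultrafilter_on_def vsubset_def by blast
  have U_kappa: "\<kappa> \<in> elts U" and U_empty: "vset {} \<notin> elts U"
    using U(1) unfolding ultrafilter_on_def by blast+
  have U_up: "b \<in> elts U" if "a \<in> elts U" "elts a \<subseteq> elts b" "elts b \<subseteq> elts \<kappa>" for a b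
    using U(1) that unfolding ultrafilter_on_def vsubset_def by blast
  have U_int: "vint a b \<in> elts U" if "a \<in> elts U" "b \<in> elts U" for a b
    using U(1) that unfolding ultrafilter_on_def vint_def by blast
  have U_prime: "a \<in> elts U \<or> vdiff \<kappa> a \<in> elts U" if "elts a \<subseteq> elts \<kappa>" for a
    using U(1) that unfolding ultrafilter_on_def vsubset_def by blast
  have disjoint: "\<not> (a \<in> elts U \<and> b \<in> elts U)" if "elts a \<inter> elts b = {}" for a b
    using U_int[of a b] U_empty that by (auto simp: vint_def)
  define I where "I = {a. elts a \<subseteq> elts \<kappa> \<and> a \<notin> elts U}"
  have I: "ideal I"
    unfolding ideal_def
  proof (intro conjI ballI allI impI)
    show "is_class I" unfolding I_def by (intro is_classI dintros)
    show "b \<in> I" if "a \<in> I" "elts b \<subseteq> elts a" for a b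
      using that U_up[of b a] by (auto simp: I_def)
    fix S assume S: "elts S \<subseteq> I \<and> few S"
    have sub: "elts (vUnion S) \<subseteq> elts \<kappa>" using S by (auto simp: I_def)
    \<comment> \<open>\<open>complete_filter\<close> speaks of nonempty families only, so the empty
      union is treated apart.\<close>
    show "vUnion S \<in> I"
    proof (cases "elts S = {}")
      case True
      then show ?thesis using U_empty by (simp add: I_def vUnion_def)
    next
      case False
      have F: "defT1 (vdiff \<kappa>)" by (intro defT1I dintros)
      let ?T = "vset (vdiff \<kappa> ` elts S)"
      have T: "elts ?T = vdiff \<kappa> ` elts S" by (rule elts_vset_image[OF F])
      have "elts ?T \<subseteq> elts U" unfolding T using S U_prime by (auto simp: I_def)
      moreover have "few ?T" using few_image[OF _ F] S by blast
      moreover have "elts ?T \<noteq> {}" unfolding T using False by blast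
      ultimately have "vset (\<Inter> (elts ` elts ?T)) \<in> elts U"
        using U(2) unfolding complete_filter_def vsubset_def by blast
      moreover have "elts (vUnion S) \<inter> elts (vset (\<Inter> (elts ` elts ?T))) = {}"
      proof -
        obtain s where "s \<in> elts ?T" using \<open>elts ?T \<noteq> {}\<close> by blast
        then have "elts (vset (\<Inter> (elts ` elts ?T))) = \<Inter> (elts ` elts ?T)"
          by (intro elts_vset small_Inter)
        then show ?thesis unfolding T by auto
      qed
      ultimately have "vUnion S \<notin> elts U" using disjoint by blast
      with sub show ?thesis by (simp add: I_def)
    qed
  qed
  have singleton: "vset {p} \<in> I" if p: "p \<in> elts \<kappa>" for p
  proof (rule ccontr)
    assume "vset {p} \<notin> I"
    then have pU: "vset {p} \<in> elts U" using p by (simp add: I_def)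
    have "a \<in> elts U \<longleftrightarrow> vsubset a \<kappa> \<and> p \<in> elts a" for a
      using disjoint[of a "vset {p}"] U_up[of "vset {p}" a] U_sub pU by (auto simp: vsubset_def)
    then have "principal_on \<kappa> U" using p unfolding principal_on_def by blast
    with U(3) show False by contradiction
  qed
  have "a \<in> I" if a: "elts a \<subseteq> elts \<kappa>" "few a" for a
  proof -
    have F: "defT1 (\<lambda>p. vset {p})" by (intro defT1I dintros)
    have "vUnion (vset ((\<lambda>p. vset {p}) ` elts a)) \<in> I"
    proof (rule ideal_vUnion[OF I])
      show "elts (vset ((\<lambda>p. vset {p}) ` elts a)) \<subseteq> I"
        unfolding elts_vset_image[OF F] using singleton a(1) by blast
      show "few (vset ((\<lambda>p. vset {p}) ` elts a))" by (rule few_image[OF a(2) F])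
    qed
    then show ?thesis by (rule ideal_subset[OF I]) (auto simp: elts_vset_image[OF F])
  qed
  moreover have "a \<in> I \<or> vdiff \<kappa> a \<in> I" if "elts a \<subseteq> elts \<kappa>" for a
    using disjoint[of a "vdiff \<kappa> a"] that by (auto simp: I_def)
  ultimately have "prime_kideal I"
    unfolding prime_kideal_def using I U_kappa by (auto simp: I_def)
  then show ?thesis by blast
qed

lemma prime_kidealD:
  assumes "prime_kideal I"
  shows "ideal I" "a \<in> I \<Longrightarrow> elts a \<subseteq> elts \<kappa>" "\<kappa> \<notin> I"
    "elts a \<subseteq> elts \<kappa> \<Longrightarrow> a \<in> I \<or> vdiff \<kappa> a \<in> I"
    "elts a \<subseteq> elts \<kappa> \<Longrightarrow> few a \<Longrightarrow> a \<in> I"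
  using assms unfolding prime_kideal_def by blast+

lemma prime_kideal_Qt_arr:
  assumes I: "prime_kideal I" shows "Qt_arr \<kappa> I {\<kappa>}"
proof -
  note I' = prime_kidealD[OF I]
  have "Qt_obj \<kappa> I"
    by (rule Qt_obj_le[OF ideal_class[OF I'(1)] card_le_subset[OF I'(2)]])
  moreover have "cov I \<subseteq> cov {\<kappa>}" unfolding cov_ideal[OF I'(1)] cov_singleton using I'(2) by blast
  ultimately show ?thesis using Qt_obj_kappa by (simp add: Qt_arr_iff)
qed

lemma prime_kideal_near:
  assumes I: "prime_kideal I" and "c \<in> I" "few (vdiff b c)" "elts b \<subseteq> elts \<kappa>"
  shows "b \<in> I"
proof (rule ideal_subset_vun[OF prime_kidealD(1)[OF I] \<open>c \<in> I\<close>])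
  show "vdiff b c \<in> I" using assms by (intro prime_kidealD(5)[OF I]) auto
qed auto

text \<open>If the ideal of \<open>Z\<close> has a member \<open>z\<close> outside \<open>I\<close>,
  then \<open>\<kappa> - z\<close> is in \<open>I\<close> by primeness, so both pieces of \<kappa>
  belong to the ideal of \<open>Z\<close>.\<close>

lemma prime_kideal_indecomposable:
  assumes I: "prime_kideal I" shows "indecomposable (Qt_arr \<kappa>) I {\<kappa>}"
  unfolding indecomposable_def
proof (intro conjI allI impI)
  note I' = prime_kidealD[OF I]
  show "Qt_arr \<kappa> I {\<kappa>}" by (rule prime_kideal_Qt_arr[OF I])
  fix Z assume Z: "Qt_arr \<kappa> I Z \<and> Qt_arr \<kappa> Z {\<kappa>}"
  then have sub: "I \<subseteq> cov Z" "cov Z \<subseteq> {a. elts a \<subseteq> elts \<kappa>}"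
    unfolding Qt_arr_iff cov_ideal[OF I'(1)] cov_singleton by blast+
  have cZ: "ideal (cov Z)" using Z by (intro ideal_cov) (simp add: Qt_arr_iff Qt_obj_def)
  show "thin_iso (Qt_arr \<kappa>) I Z \<or> thin_iso (Qt_arr \<kappa>) Z {\<kappa>}"
  proof (cases "cov Z \<subseteq> I")
    case True
    then have "cov Z \<subseteq> cov I" unfolding cov_ideal[OF I'(1)] .
    then have "Qt_arr \<kappa> Z I" using Z by (simp add: Qt_arr_iff)
    with Z show ?thesis by (simp add: thin_iso_def)
  next
    case False
    then obtain z where z: "z \<in> cov Z" "z \<notin> I" by blast
    then have "vdiff \<kappa> z \<in> cov Z" using I'(4)[of z] sub by blast
    then have "\<kappa> \<in> cov Z" by (rule ideal_subset_vun[OF cZ z(1)]) auto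
    then have "cov {\<kappa>} \<subseteq> cov Z" by (intro cov_least[OF cZ]) simp
    then have "Qt_arr \<kappa> {\<kappa>} Z" using Z by (simp add: Qt_arr_iff)
    with Z show ?thesis by (simp add: thin_iso_def)
  qed
qed

text \<open>The set \<kappa> is small enough to lift along the (wf) half. The (wc) half then puts
  all but few of its elements into one member of \<open>I\<close>, and \<open>I\<close> absorbs the
  remainder, contradicting properness.\<close>

lemma prime_kideal_not_w:
  assumes I: "prime_kideal I" shows "\<not> Qt_w \<kappa> I {\<kappa>}"
proof
  assume "Qt_w \<kappa> I {\<kappa>}"
  then obtain Z where Z: "St_wc \<kappa> I Z" "St_wf \<kappa> Z (small_unions \<kappa> {\<kappa>})"
    unfolding Qt_w_def St_w_def small_unions_ideal[OF prime_kidealD(1)[OF I]] by blast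
  have "\<kappa> \<in> small_unions \<kappa> {\<kappa>}" using subset_small_unions by blast
  then obtain z where z: "z \<in> Z" "elts \<kappa> \<subseteq> elts z"
    using St_wf_kbdd[OF Z(2) _ _ kbdd_le[OF card_le_refl]] by blast
  then obtain c where c: "c \<in> I" "few (vdiff z c)" using Z(1) unfolding St_wc_def by blast
  have "few (vdiff \<kappa> c)" by (rule few_subset[OF c(2)]) (use z(2) in auto)
  then have "\<kappa> \<in> I" using prime_kideal_near[OF I c(1)] by blast
  with prime_kidealD(3)[OF I] show False by contradiction
qed

section \<open>The invariant of the homotopy category\<close>

definition star :: "'v set \<Rightarrow> 'v set" where
  "star X = {b \<in> kbdd. \<exists>c\<in>cov X. few (vdiff b c)}"

text \<open>Approximations in \<open>cov X\<close> are chosen for the few members of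
  \<open>S\<close>; the union of the approximations misses at most the union of the errors, which is
  few by regularity.\<close>

lemma ideal_star:
  assumes X: "is_class X" shows "ideal (star X)"
  unfolding ideal_def
proof (intro conjI ballI allI impI)
  note cX = ideal_cov[OF X]
  show "is_class (star X)"
    unfolding star_def
    by (intro is_classI dintros is_classD[OF ideal_class[OF ideal_kbdd]] is_classD[OF ideal_class[OF cX]])
  show "b \<in> star X" if a: "a \<in> star X" and ba: "elts b \<subseteq> elts a" for a b
  proof -
    obtain c where c: "a \<in> kbdd" "c \<in> cov X" "few (vdiff a c)" using a unfolding star_def by blast
    have "few (vdiff b c)" by (rule few_subset[OF c(3)]) (use ba in auto)
    then show ?thesis unfolding star_def using c ideal_subset[OF ideal_kbdd c(1) ba] by blast
  qed
  fix S assume S: "elts S \<subseteq> star X \<and> few S"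
  let ?Q = "\<lambda>s c. c \<in> cov X \<and> few (vdiff s c)"
  have "\<exists>F. defT1 F \<and> (\<forall>s\<in>elts S. ?Q s (F s))"
  proof (rule class_choice[where Q = ?Q])
    show "defP2 ?Q" unfolding defP2_def by (intro dintros is_classD[OF ideal_class[OF cX]])
    show "\<exists>c. ?Q s c" if "s \<in> elts S" for s using S that unfolding star_def by blast
  qed simp
  then obtain F where F: "defT1 F" "\<forall>s\<in>elts S. ?Q s (F s)" by blast
  let ?c = "vUnion (vset (F ` elts S))" and ?G = "\<lambda>s. vdiff s (F s)"
  have G: "defT1 ?G" by (intro defT1I dintros defT1D[OF F(1)])
  have "?c \<in> cov X"
  proof (rule ideal_vUnion[OF cX])
    show "elts (vset (F ` elts S)) \<subseteq> cov X" unfolding elts_vset_image[OF F(1)] using F(2) by blast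
    show "few (vset (F ` elts S))" using S few_image[OF _ F(1)] by blast
  qed
  moreover have "few (vdiff (vUnion S) ?c)"
  proof (rule few_subset)
    show "few (vUnion (vset (?G ` elts S)))"
    proof (rule few_vUnion)
      show "few (vset (?G ` elts S))" using S few_image[OF _ G] by blast
      show "few s" if "s \<in> elts (vset (?G ` elts S))" for s
        using that F(2) unfolding elts_vset_image[OF G] by blast
    qed
    show "elts (vdiff (vUnion S) ?c) \<subseteq> elts (vUnion (vset (?G ` elts S)))"
      unfolding elts_vUnion elts_vdiff elts_vset_image[OF F(1)] elts_vset_image[OF G] by auto
  qed
  moreover have "vUnion S \<in> kbdd"
    using S by (intro ideal_vUnion[OF ideal_kbdd]) (auto simp: star_def)
  ultimately show "vUnion S \<in> star X" unfolding star_def by blast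
qed

lemma cov_kbdd_star: "cov X \<inter> kbdd \<subseteq> star X"
proof
  fix a assume "a \<in> cov X \<inter> kbdd"
  moreover have "few (vdiff a a)" by (rule few_subset[OF few_empty]) simp
  ultimately show "a \<in> star X" unfolding star_def by blast
qed

lemma few_star:
  assumes "is_class X" "few a" shows "a \<in> star X"
proof -
  have "few (vdiff a (vset {}))" by (rule few_subset[OF assms(2)]) auto
  then show ?thesis
    unfolding star_def using few_kbdd[OF assms(2)] ideal_empty[OF ideal_cov[OF assms(1)]] by blast
qed

text \<open>\<open>star Y\<close> is an ideal containing all sets of size below \<kappa>, so it
  absorbs the errors allowed by \<open>star Z\<close>.\<close>

lemma star_least:
  assumes Y: "is_class Y" and "Z \<subseteq> star Y" shows "star Z \<subseteq> star Y"
proof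
  fix b assume "b \<in> star Z"
  then obtain c where c: "c \<in> cov Z" "few (vdiff b c)" unfolding star_def by blast
  have "c \<in> star Y" using cov_least[OF ideal_star[OF Y] assms(2)] c(1) by blast
  then show "b \<in> star Y"
    by (rule ideal_subset_vun[OF ideal_star[OF Y] _ few_star[OF Y c(2)]]) auto
qed

lemma star_mono: "cov X \<subseteq> cov Y \<Longrightarrow> star X \<subseteq> star Y"
  unfolding star_def by blast

text \<open>The set \<open>b \<inter> c\<close> is in \<open>kbdd\<close>, so it lifts along the
  (wf) half to some \<open>z\<close>, which (wc) approximates by some \<open>x\<close>. The two
  errors \<open>b - c\<close> and \<open>z - x\<close> are few, and together they cover
  \<open>b - x\<close>.\<close>

lemma Qt_w_star:
  assumes "Qt_w \<kappa> X Y" shows "star Y \<subseteq> star X"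
proof
  fix b assume "b \<in> star Y"
  then obtain c where c: "b \<in> kbdd" "c \<in> cov Y" "few (vdiff b c)" unfolding star_def by blast
  obtain Z where Z: "St_wc \<kappa> (small_unions \<kappa> X) Z" "St_wf \<kappa> Z (small_unions \<kappa> Y)"
    using assms unfolding Qt_w_def St_w_def by blast
  obtain y where y: "y \<in> small_unions \<kappa> Y" "elts c \<subseteq> elts y" using c(2) unfolding cov_def by blast
  have "vint b c \<in> kbdd" by (rule ideal_subset[OF ideal_kbdd c(1)]) simp
  moreover have "elts (vint b c) \<subseteq> elts y" using y(2) by auto
  ultimately obtain z where z: "z \<in> Z" "elts (vint b c) \<subseteq> elts z"
    using St_wf_kbdd[OF Z(2) y(1)] by blast
  then obtain x where x: "x \<in> small_unions \<kappa> X" "few (vdiff z x)"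
    using Z(1) unfolding St_wc_def by blast
  have "few (vdiff b x)"
    by (rule few_subset[OF few_vun[OF c(3) x(2)]]) (use z(2) in auto)
  then show "b \<in> star X" unfolding star_def using c(1) x(1) small_unions_cov by blast
qed

text \<open>\<open>star\<close> grows along every arrow and is unchanged along (w) arrows, so its
  inclusion can be followed through a zigzag.\<close>

lemma Ho_arr_imp: "Ho_arr \<kappa> X Y \<Longrightarrow> Qt_obj \<kappa> X \<and> Qt_obj \<kappa> Y \<and> star X \<subseteq> star Y"
proof (induction rule: Ho_arr.induct)
  case (forward X Y)
  then show ?case using star_mono by (simp add: Qt_arr_iff)
next
  case (zigzag X X1 X2 Y)
  then have "star X \<subseteq> star X1" "star X1 \<subseteq> star X2"
    using star_mono Qt_w_star by (simp_all add: Qt_arr_iff)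
  with zigzag show ?case by (auto simp: Qt_arr_iff)
qed

lemma ideal_Int:
  assumes "ideal I" "ideal J" shows "ideal (I \<inter> J)"
  using assms unfolding ideal_def
  by (auto intro!: is_classI dintros is_classD[OF ideal_class[OF assms(1)]]
      is_classD[OF ideal_class[OF assms(2)]])

text \<open>The cofibrant replacement \<open>cov X \<inter> kbdd\<close> of \<open>X\<close>.\<close>

lemma Qt_w_cofibrant:
  assumes X: "Qt_obj \<kappa> X" shows "Qt_w \<kappa> (cov X \<inter> kbdd) X"
proof -
  let ?C = "cov X \<inter> kbdd"
  have C: "ideal ?C" by (intro ideal_Int ideal_kbdd ideal_cov Qt_obj_class[OF X])
  have obj: "Qt_obj \<kappa> ?C" by (rule Qt_obj_kbdd[OF ideal_class[OF C]]) blast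
  have arr: "Qt_arr \<kappa> ?C X" using obj X by (auto simp: Qt_arr_iff cov_ideal[OF C])
  then have St: "St_arr \<kappa> ?C (small_unions \<kappa> X)"
    by (simp add: Qt_arr_def small_unions_ideal[OF C])
  have "St_wc \<kappa> ?C ?C"
    unfolding St_wc_def
  proof (intro conjI ballI)
    show "St_arr \<kappa> ?C ?C"
      using St unfolding St_arr_def class_arr_def vsubset_def by blast
    show "\<exists>x\<in>?C. few (vdiff y x)" if "y \<in> ?C" for y
      using that few_subset[OF few_empty, of "vdiff y y"] by auto
  qed
  moreover have "St_wf \<kappa> ?C (small_unions \<kappa> X)"
    unfolding St_wf_def
  proof (intro conjI ballI allI impI)
    show "St_arr \<kappa> ?C (small_unions \<kappa> X)" by (rule St)
    fix x y y' assume *: "x \<in> ?C" "y \<in> small_unions \<kappa> X" "vsubset y' y"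
    \<comment> \<open>A set bounded in size by a member of \<open>kbdd\<close> plus \<kappa> is in
      \<open>kbdd\<close> again; lying below \<open>y\<close>, it belongs to \<open>?C\<close> and
      lifts to itself.\<close>
    show "\<exists>x'\<in>?C. card_le y' (vsum x \<kappa>) \<longrightarrow> vsubset y' x'"
    proof (cases "card_le y' (vsum x \<kappa>)")
      case True
      then have "y' \<in> kbdd" using kbdd_card_le kbdd_vsum *(1) by blast
      moreover have "y' \<in> cov X" using *(2,3) unfolding cov_def vsubset_def by blast
      ultimately show ?thesis by (auto simp: vsubset_def)
    qed (use * in blast)
  qed
  ultimately show ?thesis
    using arr unfolding Qt_w_def St_w_def small_unions_ideal[OF C] by blast
qed

text \<open>For the converse the zigzag is \<open>X \<leftarrow> cov X \<inter> kbdd \<rightarrow>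
  star Y \<leftarrow> cov Y \<inter> kbdd \<rightarrow> Y\<close>. The second backward arrow is even
  (wc), because \<open>b\<close> in \<open>star Y\<close> differs by few elements from
  \<open>b \<inter> c\<close>.\<close>

lemma Ho_arr_iff: "Ho_arr \<kappa> X Y \<longleftrightarrow> Qt_obj \<kappa> X \<and> Qt_obj \<kappa> Y \<and> star X \<subseteq> star Y"
proof
  assume *: "Qt_obj \<kappa> X \<and> Qt_obj \<kappa> Y \<and> star X \<subseteq> star Y"
  let ?X = "cov X \<inter> kbdd" and ?Y = "cov Y \<inter> kbdd"
  have X: "Qt_w \<kappa> ?X X" and Y: "Qt_w \<kappa> ?Y Y" using * Qt_w_cofibrant by blast+
  have S: "ideal (star Y)" using * by (intro ideal_star Qt_obj_class) blast
  have objS: "Qt_obj \<kappa> (star Y)"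
    by (rule Qt_obj_kbdd[OF ideal_class[OF S]]) (auto simp: star_def)
  have idX: "ideal ?X" and idY: "ideal ?Y"
    using * by (intro ideal_Int ideal_kbdd ideal_cov Qt_obj_class; blast)+
  have "Qt_arr \<kappa> ?X (star Y)"
    using X objS * cov_kbdd_star[of X]
    by (auto simp: Qt_arr_iff Qt_w_def cov_ideal[OF idX] cov_ideal[OF S])
  moreover have "Qt_w \<kappa> ?Y (star Y)"
  proof (intro Qt_wc_imp_w Qt_wcI)
    show "Qt_arr \<kappa> ?Y (star Y)"
      using Y objS cov_kbdd_star[of Y]
      by (simp add: Qt_arr_iff Qt_w_def cov_ideal[OF idY] cov_ideal[OF S])
    fix b assume "b \<in> cov (star Y)"
    then have "b \<in> star Y" by (simp add: cov_ideal[OF S])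
    then obtain c where c: "b \<in> kbdd" "c \<in> cov Y" "few (vdiff b c)" unfolding star_def by blast
    have "vint b c \<in> cov Y" using * by (intro ideal_subset[OF ideal_cov c(2)] Qt_obj_class) auto
    moreover have "vint b c \<in> kbdd" by (rule ideal_subset[OF ideal_kbdd c(1)]) simp
    moreover have "few (vdiff b (vint b c))" by (rule few_subset[OF c(3)]) auto
    ultimately show "\<exists>x\<in>cov ?Y. few (vdiff b x)" unfolding cov_ideal[OF idY] by blast
  qed
  moreover have "Ho_arr \<kappa> ?Y Y" using Y by (intro Ho_arr.forward) (simp add: Qt_w_def)
  ultimately have HX: "Ho_arr \<kappa> ?X Y" by (rule Ho_arr.zigzag)
  have "Qt_arr \<kappa> X X" using * by (simp add: Qt_arr_iff)
  then show "Ho_arr \<kappa> X Y" using X HX by (rule Ho_arr.zigzag)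
qed (rule Ho_arr_imp)

text \<open>A failing arrow back would make \<open>star X\<close> prime on some \<open>b\<close>
  outside it, hence missing a singleton of \<open>b\<close>; but \<open>star X\<close> contains all
  sets of size below \<kappa>.\<close>

lemma Ho_indecomposable_iso:
  assumes nm: "\<not> measurable \<kappa>" and ind: "indecomposable (Ho_arr \<kappa>) X Y"
  shows "Ho_arr \<kappa> Y X"
proof (rule ccontr)
  assume "\<not> Ho_arr \<kappa> Y X"
  moreover have "Ho_arr \<kappa> X Y" using ind by (simp add: indecomposable_def)
  ultimately have XY: "Qt_obj \<kappa> X" "Qt_obj \<kappa> Y" "star X \<subseteq> star Y" "\<not> star Y \<subseteq> star X"
    by (auto simp: Ho_arr_iff)
  have X: "ideal (star X)" and Y: "ideal (star Y)"
    using XY by (auto intro: ideal_star Qt_obj_class)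
  \<comment> \<open>Any witness lies in \<open>kbdd\<close>; \<open>kbdd_induct\<close> refines it
    to one of size at most \<kappa>, as the transport to \<kappa> requires.\<close>
  obtain b where b: "b \<in> star Y" "b \<notin> star X" "card_le b \<kappa>"
  proof -
    obtain d where d: "d \<in> star Y" "d \<notin> star X" using XY(4) by blast
    then have "d \<in> kbdd" by (simp add: star_def)
    then obtain a where "elts a \<subseteq> elts d" "card_le a \<kappa>" "a \<notin> star X"
      using kbdd_induct[OF _ X] d(2) by blast
    then show thesis using that ideal_subset[OF Y d(1)] by blast
  qed
  have prime: "a \<in> star X \<or> vdiff b a \<in> star X" if a: "elts a \<subseteq> elts b" for a
  proof -
    \<comment> \<open>Adjoining \<open>a\<close> to \<open>star X\<close> rather than to
      \<open>X\<close> keeps the class inside \<open>kbdd\<close>, which makes it an object.\<close>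
    let ?Z = "insert a (star X)"
    have aY: "a \<in> star Y" by (rule ideal_subset[OF Y b(1) a])
    have sub: "?Z \<subseteq> kbdd" using aY XY(3) by (auto simp: star_def)
    have Zc: "is_class ?Z" by (intro is_class_insert ideal_class X)
    have Z: "Qt_obj \<kappa> ?Z" by (rule Qt_obj_kbdd[OF Zc sub])
    have Zstar: "?Z \<subseteq> star ?Z" using subset_cov[of ?Z] sub cov_kbdd_star[of ?Z] by blast
    moreover have "star ?Z \<subseteq> star Y"
      by (rule star_least[OF Qt_obj_class[OF XY(2)]]) (use aY XY(3) in blast)
    ultimately have "Ho_arr \<kappa> X ?Z" "Ho_arr \<kappa> ?Z Y" using XY Z by (auto simp: Ho_arr_iff)
    then have "Ho_arr \<kappa> ?Z X \<or> Ho_arr \<kappa> Y ?Z"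
      using ind unfolding indecomposable_def thin_iso_def by blast
    then show ?thesis
    proof
      assume "Ho_arr \<kappa> ?Z X"
      then show ?thesis using Zstar by (auto simp: Ho_arr_iff)
    next
      assume "Ho_arr \<kappa> Y ?Z"
      then have "b \<in> star ?Z" using b(1) by (auto simp: Ho_arr_iff)
      then obtain c where c: "c \<in> cov ?Z" "few (vdiff b c)" unfolding star_def by blast
      have "vdiff c a \<in> star X" using cov_insert[OF c(1)] cov_ideal[OF X] by simp
      moreover have "vdiff b c \<in> star X" by (rule few_star[OF Qt_obj_class[OF XY(1)] c(2)])
      ultimately have "vdiff b a \<in> star X" by (rule ideal_subset_vun[OF X]) auto
      then show ?thesis ..
    qed
  qed
  obtain q where "vset {q} \<notin> star X"
    using prime_ideal_principal[OF nm X b(3,2) prime] by blast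
  with few_star[OF Qt_obj_class[OF XY(1)] few_singleton] show False by blast
qed

lemma star_kappa: "b \<in> star {\<kappa>} \<longleftrightarrow> b \<in> kbdd \<and> few (vdiff b \<kappa>)"
proof
  assume "b \<in> star {\<kappa>}"
  then obtain c where c: "b \<in> kbdd" "elts c \<subseteq> elts \<kappa>" "few (vdiff b c)"
    unfolding star_def cov_singleton by blast
  have "few (vdiff b \<kappa>)" by (rule few_subset[OF c(3)]) (use c(2) in auto)
  with c(1) show "b \<in> kbdd \<and> few (vdiff b \<kappa>)" by blast
qed (auto simp: star_def cov_singleton)

text \<open>The argument of the uninverted category, except that members of \<open>star Z\<close>
  may leave \<kappa> by few elements; they are therefore tested through their intersection with
  \<kappa>.\<close>

lemma prime_kideal_Ho_indecomposable:
  assumes I: "prime_kideal I" shows "indecomposable (Ho_arr \<kappa>) I {\<kappa>}"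
  unfolding indecomposable_def
proof (intro conjI allI impI)
  note I' = prime_kidealD[OF I]
  have objI: "Qt_obj \<kappa> I" using prime_kideal_Qt_arr[OF I] by (simp add: Qt_arr_iff)
  show "Ho_arr \<kappa> I {\<kappa>}" by (intro Ho_arr.forward prime_kideal_Qt_arr I)
  fix Z assume Z: "Ho_arr \<kappa> I Z \<and> Ho_arr \<kappa> Z {\<kappa>}"
  then have objZ: "Qt_obj \<kappa> Z" and sub: "star I \<subseteq> star Z" "star Z \<subseteq> star {\<kappa>}"
    by (simp_all add: Ho_arr_iff)
  have SZ: "ideal (star Z)" by (rule ideal_star[OF Qt_obj_class[OF objZ]])
  have I_star: "I \<subseteq> star I"
  proof -
    have "I \<subseteq> kbdd" using kbdd_le card_le_subset I'(2) by blast
    then show ?thesis using cov_kbdd_star[of I] cov_ideal[OF I'(1)] by blast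
  qed
  show "thin_iso (Ho_arr \<kappa>) I Z \<or> thin_iso (Ho_arr \<kappa>) Z {\<kappa>}"
  proof (cases "\<forall>b\<in>star Z. vint b \<kappa> \<in> I")
    case True
    have "b \<in> star I" if b: "b \<in> star Z" for b
    proof -
      have bk: "b \<in> kbdd" "few (vdiff b \<kappa>)" using b sub(2) star_kappa by blast+
      have "few (vdiff b (vint b \<kappa>))" by (rule few_subset[OF bk(2)]) auto
      with bk(1) show ?thesis
        unfolding star_def cov_ideal[OF I'(1)] using True b by blast
    qed
    then have "Ho_arr \<kappa> Z I" using objZ objI by (auto simp: Ho_arr_iff)
    with Z show ?thesis by (simp add: thin_iso_def)
  next
    case False
    then obtain b where b: "b \<in> star Z" "vint b \<kappa> \<notin> I" by blast
    then have "vdiff \<kappa> (vint b \<kappa>) \<in> I" using I'(4)[of "vint b \<kappa>"] by simp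
    then have "vdiff \<kappa> (vint b \<kappa>) \<in> star Z" using I_star sub(1) by blast
    then have kZ: "\<kappa> \<in> star Z" by (rule ideal_subset_vun[OF SZ b(1)]) auto
    have "{\<kappa>} \<subseteq> star Z" using kZ by blast
    then have "star {\<kappa>} \<subseteq> star Z" by (rule star_least[OF Qt_obj_class[OF objZ]])
    then have "Ho_arr \<kappa> {\<kappa>} Z" using objZ Qt_obj_kappa by (simp add: Ho_arr_iff)
    with Z show ?thesis by (simp add: thin_iso_def)
  qed
qed

lemma prime_kideal_not_Ho_iso:
  assumes I: "prime_kideal I" shows "\<not> Ho_arr \<kappa> {\<kappa>} I"
proof
  note I' = prime_kidealD[OF I]
  assume "Ho_arr \<kappa> {\<kappa>} I"
  moreover have "\<kappa> \<in> star {\<kappa>}"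
    unfolding star_kappa using few_subset[OF few_empty, of "vdiff \<kappa> \<kappa>"] kbdd_le[OF card_le_refl] by simp
  ultimately have "\<kappa> \<in> star I" by (auto simp: Ho_arr_iff)
  then obtain c where "c \<in> I" "few (vdiff \<kappa> c)" unfolding star_def cov_ideal[OF I'(1)] by blast
  then have "\<kappa> \<in> I" using prime_kideal_near[OF I] by blast
  with I'(3) show False by contradiction
qed

end

theorem lemma18:
  fixes \<kappa> :: "'v::zfc_model"
  assumes "regular_cardinal \<kappa>" and "omega \<in> elts \<kappa>"
  shows
    "(\<not> measurable \<kappa> \<longleftrightarrow>
       (\<forall>X. indecomposable (Qt_arr \<kappa>) X {\<kappa>} \<longrightarrow> Qt_w \<kappa> X {\<kappa>})) \<and>
     (\<not> measurable \<kappa> \<longleftrightarrow>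
       (\<forall>X Y. indecomposable (Qt_arr \<kappa>) X Y \<and> Qt_c \<kappa> {} Y \<longrightarrow> Qt_wc \<kappa> X Y)) \<and>
     (\<not> measurable \<kappa> \<longleftrightarrow>
       (\<forall>X Y. indecomposable (Ho_arr \<kappa>) X Y \<longrightarrow> Ho_arr \<kappa> Y X))"
proof -
  interpret regular \<kappa> by (rule regular.intro[OF assms])
  show ?thesis
  proof (cases "measurable \<kappa>")
    case True
    then obtain I where I: "prime_kideal I" using measurable_prime_kideal by blast
    have "\<not> Qt_wc \<kappa> I {\<kappa>}" using prime_kideal_not_w[OF I] Qt_wc_imp_w by blast
    with True show ?thesis
      using prime_kideal_not_w[OF I] prime_kideal_indecomposable[OF I] Qt_c_empty_kappa
        prime_kideal_Ho_indecomposable[OF I] prime_kideal_not_Ho_iso[OF I] by blast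
  next
    case False
    \<comment> \<open>The second condition is the third at \<open>Y = {\<kappa>}\<close>, where the
      arrow from the initial object is labelled (c), and (wc) implies (w).\<close>
    have "\<forall>X. indecomposable (Qt_arr \<kappa>) X {\<kappa>} \<longrightarrow> Qt_w \<kappa> X {\<kappa>}"
      using indecomposable_wc[OF False _ Qt_c_empty_kappa] Qt_wc_imp_w by blast
    with False show ?thesis
      using indecomposable_wc[OF False] Ho_indecomposable_iso[OF False] by blast
  qed
qed

end
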